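(* Let $R$ be a quotient root system with base $S$ and let $\Phi \subseteq R^+$ be a non-empty inversion set. The following are equivalent: (i) $\Phi$ is irreducible; (ii) every connected component $C$ of $G_\Phi^{\Phi^c}$ satisfies $\operatorname{supp} C = \operatorname{supp} \Phi$; (iii) $G_\Phi^{\Phi^c}$ has a unique simple component; (iv) there exists a component $A$ of $G_\Phi^{\Phi^c}$ such that every other component $C$ of $G_\Phi^{\Phi^c}$ satisfies $C = kA$ for some integer $k \geq 1$.
   Context: A quotient root system (QRS) $R$ is the set of non-zero images of a root system $\Delta$ (with base $\Sigma$) under the orthogonal projection of its ambient Euclidean space onto $(\mathrm{span}\,J)^\perp$ for some $J\subsetneq\Sigma$; its base $S$ consists of the images of $\Sigma\setminus J$, and every root is an integer combination of $S$ with all coefficients $\ge0$ (positive roots, $R^+$) or all $\le0$. The support $\operatorname{supp}\alpha$ of a root is the set of $\theta\in S$ with non-zero coefficient in $\alpha$; the support of a set is the union of the supports of its elements. $\Phi\subseteq R^+$ is closed if $\alpha,\beta\in\Phi$, $\alpha+\beta\in R$ imply $\alpha+\beta\in\Phi$; co-closed if $\Phi^c := R^+\setminus\Phi$ is closed; an inversion set if both. A non-empty inversion set $\Phi$ is irreducible if whenever $\Phi=\Phi_1\sqcup\Phi_2$ with $\Phi_1,\Phi_2$ disjoint inversion sets, then $\Phi_1=\Phi$ or $\Phi_2=\Phi$. $G_\Phi^{\Phi^c}$ is the graph with vertex set $\Phi$ in which $\alpha,\alpha'$ are adjacent iff $\alpha-\alpha'\in \Phi^c\cup(-\Phi^c)$;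 "components" are its connected components (as sets of roots). Addition of components: for components $A,B$ let $Z=\{\alpha+\beta:\alpha\in A,\beta\in B\}\cap R$. If $Z\neq\emptyset$ and $Z$ lies in a single component $C$, then $A+B:=C$. If $Z$ meets more than one component, then (as established in the paper) $A=B$ and $Z$ meets exactly two components, $A$ and some $C\ne A$; then $A+A:=C$. If $Z=\emptyset$, $A+B$ is undefined. For components $C_1,\dots,C_n$ the standard sum $C_1+\cdots+C_n$ means $(\cdots((C_1+C_2)+C_3)+\cdots)+C_n$, required to have every partial sum defined; $kA$ is the standard sum of $k$ copies of $A$. A component $C$ is simple if whenever $A+B=C$ for components $A,B$, then $A=C$ or $B=C$. *)

theory Defs
  imports "HOL-Analysis.Analysis"
begin

definition root_system :: "'a::euclidean_space set \<Rightarrow> bool" where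
  "root_system \<Delta> \<longleftrightarrow>
     finite \<Delta> \<and> 0 \<notin> \<Delta> \<and>
     (\<forall>\<alpha>\<in>\<Delta>. \<forall>\<beta>\<in>\<Delta>. \<beta> - (2 * (\<beta> \<bullet> \<alpha>) / (\<alpha> \<bullet> \<alpha>)) *\<^sub>R \<alpha> \<in> \<Delta>) \<and>
     (\<forall>\<alpha>\<in>\<Delta>. \<forall>\<beta>\<in>\<Delta>. 2 * (\<beta> \<bullet> \<alpha>) / (\<alpha> \<bullet> \<alpha>) \<in> \<int>) \<and>
     (\<forall>\<alpha>\<in>\<Delta>. \<forall>c::real. c *\<^sub>R \<alpha> \<in> \<Delta> \<longrightarrow> c = 1 \<or> c = -1)"

definition root_base :: "'a::euclidean_space set \<Rightarrow> 'a set \<Rightarrow> bool" where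
  "root_base \<Delta> \<Sigma> \<longleftrightarrow> \<Sigma> \<subseteq> \<Delta> \<and> independent \<Sigma> \<and>
     (\<forall>\<beta>\<in>\<Delta>. \<exists>c::'a \<Rightarrow> int. \<beta> = (\<Sum>\<alpha>\<in>\<Sigma>. of_int (c \<alpha>) *\<^sub>R \<alpha>) \<and>
        ((\<forall>\<alpha>\<in>\<Sigma>. c \<alpha> \<ge> 0) \<or> (\<forall>\<alpha>\<in>\<Sigma>. c \<alpha> \<le> 0)))"

definition perp_proj :: "'a::euclidean_space set \<Rightarrow> 'a \<Rightarrow> 'a" where
  "perp_proj J x = (THE p. (\<forall>j\<in>J. p \<bullet> j = 0) \<and> x - p \<in> span J)"

definition qrs_roots :: "'a::euclidean_space set \<Rightarrow> 'a set \<Rightarrow> 'a set" where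
  "qrs_roots \<Delta> J = {perp_proj J \<alpha> | \<alpha>. \<alpha> \<in> \<Delta> \<and> perp_proj J \<alpha> \<noteq> 0}"

definition qrs_base :: "'a::euclidean_space set \<Rightarrow> 'a set \<Rightarrow> 'a set" where
  "qrs_base \<Sigma> J = perp_proj J ` (\<Sigma> - J)"

definition coeffs :: "'a::euclidean_space set \<Rightarrow> 'a \<Rightarrow> 'a \<Rightarrow> int" where
  "coeffs S \<alpha> = (THE c. (\<forall>\<theta>. \<theta> \<notin> S \<longrightarrow> c \<theta> = 0) \<and>
                          \<alpha> = (\<Sum>\<theta>\<in>S. of_int (c \<theta>) *\<^sub>R \<theta>))"

definition supp :: "'a::euclidean_space set \<Rightarrow> 'a \<Rightarrow> 'a set" where
  "supp S \<alpha> = {\<theta>\<in>S. coeffs S \<alpha> \<theta> \<noteq> 0}"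

definition supp_set :: "'a::euclidean_space set \<Rightarrow> 'a set \<Rightarrow> 'a set" where
  "supp_set S X = (\<Union>\<alpha>\<in>X. supp S \<alpha>)"

definition pos_roots :: "'a::euclidean_space set \<Rightarrow> 'a set \<Rightarrow> 'a set" where
  "pos_roots R S = {\<alpha>\<in>R. \<forall>\<theta>\<in>S. coeffs S \<alpha> \<theta> \<ge> 0}"

definition closed_set :: "'a::euclidean_space set \<Rightarrow> 'a set \<Rightarrow> 'a set \<Rightarrow> bool" where
  "closed_set R S \<Phi> \<longleftrightarrow> \<Phi> \<subseteq> pos_roots R S \<and>
     (\<forall>\<alpha>\<in>\<Phi>. \<forall>\<beta>\<in>\<Phi>. \<alpha> + \<beta> \<in> R \<longrightarrow> \<alpha> + \<beta> \<in> \<Phi>)"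

definition coclosed_set :: "'a::euclidean_space set \<Rightarrow> 'a set \<Rightarrow> 'a set \<Rightarrow> bool" where
  "coclosed_set R S \<Phi> \<longleftrightarrow> \<Phi> \<subseteq> pos_roots R S \<and> closed_set R S (pos_roots R S - \<Phi>)"

definition inversion_set :: "'a::euclidean_space set \<Rightarrow> 'a set \<Rightarrow> 'a set \<Rightarrow> bool" where
  "inversion_set R S \<Phi> \<longleftrightarrow> closed_set R S \<Phi> \<and> coclosed_set R S \<Phi>"

definition irreducible_inv :: "'a::euclidean_space set \<Rightarrow> 'a set \<Rightarrow> 'a set \<Rightarrow> bool" where
  "irreducible_inv R S \<Phi> \<longleftrightarrow> inversion_set R S \<Phi> \<and> \<Phi> \<noteq> {} \<and>
     (\<forall>\<Phi>1 \<Phi>2. inversion_set R S \<Phi>1 \<and> inversion_set R S \<Phi>2 \<and> \<Phi>1 \<inter> \<Phi>2 = {} \<and>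
        \<Phi> = \<Phi>1 \<union> \<Phi>2 \<longrightarrow> \<Phi>1 = \<Phi> \<or> \<Phi>2 = \<Phi>)"

definition inv_graph_edges :: "'a::euclidean_space set \<Rightarrow> 'a set \<Rightarrow> 'a set \<Rightarrow> ('a \<times> 'a) set" where
  "inv_graph_edges R S \<Phi> =
     {(\<alpha>, \<alpha>'). \<alpha> \<in> \<Phi> \<and> \<alpha>' \<in> \<Phi> \<and>
        \<alpha> - \<alpha>' \<in> (pos_roots R S - \<Phi>) \<union> uminus ` (pos_roots R S - \<Phi>)}"

definition components :: "'a::euclidean_space set \<Rightarrow> 'a set \<Rightarrow> 'a set \<Rightarrow> 'a set set" where
  "components R S \<Phi> =
     {{\<alpha>'\<in>\<Phi>. (\<alpha>, \<alpha>') \<in> (inv_graph_edges R S \<Phi>)\<^sup>*} | \<alpha>. \<alpha> \<in> \<Phi>}"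

definition comp_Z :: "'a::euclidean_space set \<Rightarrow> 'a set \<Rightarrow> 'a set \<Rightarrow> 'a set" where
  "comp_Z R A B = {\<alpha> + \<beta> | \<alpha> \<beta>. \<alpha> \<in> A \<and> \<beta> \<in> B} \<inter> R"

definition comp_add :: "'a::euclidean_space set \<Rightarrow> 'a set \<Rightarrow> 'a set \<Rightarrow> 'a set \<Rightarrow> 'a set \<Rightarrow> 'a set option" where
  "comp_add R S \<Phi> A B =
     (let Z = comp_Z R A B; Cs = components R S \<Phi> in
      if Z \<noteq> {} \<and> (\<exists>C\<in>Cs. Z \<subseteq> C) then Some (THE C. C \<in> Cs \<and> Z \<subseteq> C)
      else if A = B \<and> A \<in> Cs \<and> (\<exists>C\<in>Cs. C \<noteq> A \<and>
                {D\<in>Cs. D \<inter> Z \<noteq> {}} = {A, C})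
        then Some (THE C. C \<in> Cs \<and> C \<noteq> A \<and> {D\<in>Cs. D \<inter> Z \<noteq> {}} = {A, C})
      else None)"

fun comp_mult :: "'a::euclidean_space set \<Rightarrow> 'a set \<Rightarrow> 'a set \<Rightarrow> nat \<Rightarrow> 'a set \<Rightarrow> 'a set option" where
  "comp_mult R S \<Phi> 0 A = None"
| "comp_mult R S \<Phi> (Suc 0) A = Some A"
| "comp_mult R S \<Phi> (Suc (Suc k)) A =
     (case comp_mult R S \<Phi> (Suc k) A of None \<Rightarrow> None | Some X \<Rightarrow> comp_add R S \<Phi> X A)"

definition simple_comp :: "'a::euclidean_space set \<Rightarrow> 'a set \<Rightarrow> 'a set \<Rightarrow> 'a set \<Rightarrow> bool" where
  "simple_comp R S \<Phi> C \<longleftrightarrow> C \<in> components R S \<Phi> \<and>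
     (\<forall>A\<in>components R S \<Phi>. \<forall>B\<in>components R S \<Phi>.
        comp_add R S \<Phi> A B = Some C \<longrightarrow> A = C \<or> B = C)"

end

theory Submission
  imports Defs
begin

text \<open>
  The only property of a quotient root system that is used beyond its base is that two roots with
  negative inner product have a root or zero as their sum. It follows that whenever \<open>a\<close>, \<open>b\<close>, \<open>c\<close>,
  \<open>a + b\<close> and \<open>a + b + c\<close> are roots, \<open>a + c\<close> or \<open>b + c\<close> is a root or zero. A step along an edge
  applied to a sum of roots can therefore be passed on to one of the summands, or one summand can be
  traded against the other. Trading along shortest paths shows that addition of components is
  well defined and cancellative.

  For the component \<open>A\<close> of a simple root, the components generated from \<open>A\<close> by adding \<open>A\<close> form an
  inversion set whose complement in \<open>\<Phi>\<close> is one too; this gives (i) \<open>\<Longrightarrow>\<close> (iv) \<open>\<Longrightarrow>\<close> (iii) \<open>\<Longrightarrow>\<close> (i).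
  The components inside \<open>span T\<close>, where \<open>T\<close> is the support of a component, also split off from \<open>\<Phi>\<close>,
  which gives (i) \<open>\<Longrightarrow>\<close> (ii). Conversely, a co-closed set contained in a symmetric closed set \<open>D\<close> has its
  support in \<open>D\<close>. If simple roots \<open>s\<close> and \<open>t\<close> lie in different components \<open>A\<close> and \<open>B\<close>, and \<open>t\<close> is in
  the support of \<open>A\<close>, then taking for \<open>D\<close> the stabiliser of a suitable set of roots containing \<open>t\<close>
  shows that \<open>A + B = A\<close>; by symmetry \<open>A\<close> and \<open>B\<close> cannot both have full support.
\<close>

section \<open>Exchange along shortest paths\<close>

text \<open>In a pair of configurations at minimal distance every step must trade between the two
  coordinates, so the sums are preserved. Sliding the two configurations past each other in turn then
  translates them by the difference of the sums forever, contradicting finiteness.\<close>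

lemma exchange_equal_sums:
  fixes T1 T2 E1 E2 :: "('a::real_vector \<times> 'a) set"
  assumes fin: "finite (fst ` T2)" and sym: "sym E1" "sym E2"
    and step1: "\<And>x y x1. \<lbrakk>(x, y) \<in> T1; (x, x1) \<in> E1\<rbrakk>
      \<Longrightarrow> (x1, y) \<in> T1 \<or> (x1, x + y - x1) \<in> T1 \<and> (y, x + y - x1) \<in> E2"
    and step2: "\<And>x y y1. \<lbrakk>(x, y) \<in> T2; (y, y1) \<in> E2\<rbrakk>
      \<Longrightarrow> (x, y1) \<in> T2 \<or> (x + y - y1, y1) \<in> T2 \<and> (x, x + y - y1) \<in> E1"
    and start: "(a, b) \<in> T1" "(a', b') \<in> T2" "(a, a') \<in> E1\<^sup>*" "(b, b') \<in> E2\<^sup>*"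
  shows "\<exists>(x, y)\<in>T1. \<exists>(x', y')\<in>T2. x + y = x' + y'"
proof (rule ccontr)
  assume neq: "\<not> ?thesis"
  define cfg where "cfg i j x y x' y' \<longleftrightarrow> (x, y) \<in> T1 \<and> (x', y') \<in> T2 \<and> (x, x') \<in> E1 ^^ i \<and> (y, y') \<in> E2 ^^ j"
    for i j x y x' y'
  define Q where "Q n \<longleftrightarrow> (\<exists>i j x y x' y'. i + j = n \<and> cfg i j x y x' y')" for n
  define N where "N = (LEAST n. Q n)"
  obtain i j where "(a, a') \<in> E1 ^^ i" "(b, b') \<in> E2 ^^ j"
    using start rtrancl_imp_relpow by blast
  then have "cfg i j a b a' b'" using start by (simp add: cfg_def)
  then have "Q (i + j)" unfolding Q_def by (intro exI[of _ i] exI[of _ j] exI conjI) (rule refl)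
  then have QN: "Q N" unfolding N_def by (rule LeastI)
  have min: "N \<le> i + j" if "cfg i j x y x' y'" for i j x y x' y'
  proof -
    have "Q (i + j)" unfolding Q_def using that by (intro exI[of _ i] exI[of _ j] exI conjI) (rule refl)
    then show ?thesis unfolding N_def by (rule Least_le)
  qed
  have push1: "cfg 0 N x' (x + y - x') x' y'" if "cfg i j x y x' y'" "i + j = N" for i j x y x' y'
    using that
  proof (induction i arbitrary: j x y)
    case 0
    then show ?case by (auto simp: cfg_def)
  next
    case (Suc i)
    obtain x1 where x1: "(x, x1) \<in> E1" "(x1, x') \<in> E1 ^^ i"
      using Suc.prems(1) relpow_Suc_D2[of x x' i E1] unfolding cfg_def by blast
    have "(x1, y) \<notin> T1"
      using min[of i j x1 y x' y'] Suc.prems x1 unfolding cfg_def by linarith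
    then have *: "(x1, x + y - x1) \<in> T1" "(x + y - x1, y) \<in> E2"
      using step1[of x y x1] x1 Suc.prems(1) symD[OF sym(2)] unfolding cfg_def by blast+
    have "(y, y') \<in> E2 ^^ j" using Suc.prems(1) unfolding cfg_def by blast
    with * have "cfg i (Suc j) x1 (x + y - x1) x' y'"
      using Suc.prems(1) x1 relpow_Suc_I2[of "x + y - x1" y E2 y' j] unfolding cfg_def by blast
    from Suc.IH[OF this] Suc.prems show ?case by simp
  qed
  have push2: "cfg N 0 x y (x' + y' - y) y" if "cfg i j x y x' y'" "i + j = N" for i j x y x' y'
    using that
  proof (induction j arbitrary: i x' y')
    case 0
    then show ?case by (auto simp: cfg_def)
  next
    case (Suc j)
    obtain y1 where y1: "(y, y1) \<in> E2 ^^ j" "(y1, y') \<in> E2"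
      using Suc.prems(1) relpow_Suc_E[of y y' j E2] unfolding cfg_def by metis
    have e: "(y', y1) \<in> E2" using symD[OF sym(2) y1(2)] .
    have "(x', y1) \<notin> T2"
      using min[of i j x y x' y1] Suc.prems y1 unfolding cfg_def by linarith
    then have *: "(x' + y' - y1, y1) \<in> T2" "(x', x' + y' - y1) \<in> E1"
      using step2[of x' y' y1] e Suc.prems(1) unfolding cfg_def by blast+
    then have "cfg (Suc i) j x y (x' + y' - y1) y1"
      using Suc.prems(1) y1 relpow_Suc_I[of x x' i E1] unfolding cfg_def by blast
    from Suc.IH[OF this] Suc.prems show ?case by simp
  qed
  obtain i j x y x' y' where c0: "i + j = N" "cfg i j x y x' y'"
    using QN unfolding Q_def by blast
  define v where "v = x' + y' - (x + y)"
  have v0: "v \<noteq> 0" using neq c0 by (force simp: v_def cfg_def)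
  have iter: "\<exists>i j u w z. i + j = N \<and> cfg i j u w (x' + of_nat k *\<^sub>R v) z
      \<and> u + w = x + y \<and> x' + of_nat k *\<^sub>R v + z = x' + y'" for k
  proof (induction k)
    case 0
    then show ?case using c0 by auto
  next
    case (Suc k)
    define p where "p = x' + of_nat k *\<^sub>R v"
    obtain i j u w z where c: "i + j = N" "cfg i j u w p z" "u + w = x + y" "p + z = x' + y'"
      using Suc unfolding p_def by auto
    \<comment> \<open>The \<open>T1\<close> pair is traded until it shares the first coordinate
      \<open>p\<close>, then the \<open>T2\<close> pair until it shares the second coordinate
      \<open>x + y - p\<close>. Both sums are kept, so the \<open>T2\<close> pair's first coordinate
      grows by \<open>v\<close>.\<close>
    have "cfg 0 N p (x + y - p) p z"
      using push1[OF c(2,1)] c(3) by simp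
    from push2[OF this] have "cfg N 0 p (x + y - p) (x' + y' - (x + y - p)) (x + y - p)"
      using c(4) by simp
    moreover have "x' + y' - (x + y - p) = x' + of_nat (Suc k) *\<^sub>R v"
      by (simp add: p_def v_def algebra_simps)
    ultimately have *: "cfg N 0 p (x + y - p) (x' + of_nat (Suc k) *\<^sub>R v) (x + y - p)"
      by (simp only:)
    have "x' + of_nat (Suc k) *\<^sub>R v + (x + y - p) = x' + y'"
      by (simp add: p_def v_def algebra_simps)
    with * show ?case by (intro exI[of _ N] exI[of _ 0] exI[of _ p] exI[of _ "x + y - p"]) simp
  qed
  have "range (\<lambda>k. x' + of_nat k *\<^sub>R v) \<subseteq> fst ` T2"
  proof safe
    fix k
    from iter[of k] obtain z where "(x' + of_nat k *\<^sub>R v, z) \<in> T2"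
      unfolding cfg_def by blast
    then show "x' + of_nat k *\<^sub>R v \<in> fst ` T2" by force
  qed
  moreover have "inj (\<lambda>k::nat. x' + of_nat k *\<^sub>R v)"
    using v0 by (auto simp: inj_def)
  ultimately show False
    using fin finite_subset range_inj_infinite by blast
qed

section \<open>Two closed sets partitioning the positive roots\<close>

text \<open>No base occurs among the data, so that the sign change in \<open>twist\<close> produces
  another instance with the same \<open>R\<close> and \<Psi>.\<close>

locale root_partition =
  fixes R \<Phi> \<Psi> :: "'a::euclidean_space set"
  assumes finite_R: "finite R"
    and add_root: "\<lbrakk>x \<in> R; y \<in> R; x \<bullet> y < 0\<rbrakk> \<Longrightarrow> x + y \<in> insert 0 R"
    and R_iff: "x \<in> R \<longleftrightarrow> x \<in> \<Phi> \<or> x \<in> \<Psi> \<or> -x \<in> \<Phi> \<or> -x \<in> \<Psi>"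
    and disjoint: "x \<in> \<Phi> \<Longrightarrow> x \<notin> \<Psi>"
    and pos: "x \<in> \<Phi> \<union> \<Psi> \<Longrightarrow> -x \<notin> \<Phi> \<union> \<Psi>"
    and closed_Phi: "\<lbrakk>x \<in> \<Phi>; y \<in> \<Phi>; x + y \<in> R\<rbrakk> \<Longrightarrow> x + y \<in> \<Phi>"
    and closed_Psi: "\<lbrakk>x \<in> \<Psi>; y \<in> \<Psi>; x + y \<in> R\<rbrakk> \<Longrightarrow> x + y \<in> \<Psi>"
begin

lemma zero_notin: "0 \<notin> R"
  using R_iff[of 0] pos[of 0] by auto

lemma uminus_R [simp]: "-x \<in> R \<longleftrightarrow> x \<in> R"
  using R_iff by auto

lemma Phi_R: "x \<in> \<Phi> \<Longrightarrow> x \<in> R"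
  using R_iff by auto

lemma finite_Phi: "finite \<Phi>"
  using finite_subset[OF _ finite_R] Phi_R by blast

lemma diff_root: "\<lbrakk>x \<in> R; y \<in> R; x \<bullet> y > 0\<rbrakk> \<Longrightarrow> x - y \<in> insert 0 R"
  using add_root[of x "-y"] by simp

text \<open>If both sums fail, \<open>c\<close> has non-negative and \<open>a + b + c\<close>
  non-positive inner product with each of \<open>a\<close> and \<open>b\<close>. But the product of
  \<open>a + b + c\<close> with \<open>a + b\<close> is then at least the squared norm of
  \<open>a + b\<close>, which is positive.\<close>

lemma jacobi:
  assumes "a \<in> R" "b \<in> R" "c \<in> R" "a + b \<in> R" "a + b + c \<in> R"
  shows "a + c \<in> insert 0 R \<or> b + c \<in> insert 0 R"
proof (rule ccontr)
  assume *: "\<not> ?thesis"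
  let ?d = "a + b + c"
  have 1: "a \<bullet> c \<ge> 0" "b \<bullet> c \<ge> 0"
    using * add_root assms by (meson not_le)+
  have "?d \<bullet> a \<le> 0" "?d \<bullet> b \<le> 0"
    using * diff_root[of ?d a] diff_root[of ?d b] assms by (auto simp: not_less[symmetric] algebra_simps)
  then have "?d \<bullet> (a + b) \<le> 0" by (simp add: inner_add_right)
  moreover have "?d \<bullet> (a + b) = (a + b) \<bullet> (a + b) + a \<bullet> c + b \<bullet> c"
    by (simp add: inner_add_left inner_add_right inner_commute)
  moreover have "(a + b) \<bullet> (a + b) > 0"
    using assms zero_notin by auto
  ultimately show False using 1 by linarith
qed

text \<open>The squared norm of the common sum expands into four inner products, one of which is
  positive and gives a difference. Differences from \<open>b\<close> are negatives of those from
  \<open>a\<close>.\<close>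

lemma refine:
  assumes "a \<in> R" "b \<in> R" "c \<in> R" "d \<in> R" "a + b = c + d" "a + b \<noteq> 0"
  shows "a - c \<in> insert 0 R \<or> a - d \<in> insert 0 R"
proof -
  have "(a + b) \<bullet> (c + d) > 0" using assms by simp
  then consider "a \<bullet> c > 0" | "a \<bullet> d > 0" | "b \<bullet> c > 0" | "b \<bullet> d > 0"
    by (fastforce simp: inner_add_left inner_add_right)
  then have "a - c \<in> insert 0 R \<or> a - d \<in> insert 0 R \<or> b - c \<in> insert 0 R \<or> b - d \<in> insert 0 R"
    using diff_root assms by metis
  moreover have "b - c = - (a - d)" "b - d = - (a - c)"
    using assms(5) by (simp_all add: algebra_simps)
  ultimately show ?thesis by (metis (no_types) insert_iff neg_equal_0_iff_equal uminus_R)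
qed

lemma add_nonzero: "\<lbrakk>x \<in> \<Phi> \<union> \<Psi>; y \<in> \<Phi> \<union> \<Psi>\<rbrakk> \<Longrightarrow> x + y \<noteq> 0"
  using pos by (metis add_eq_0_iff)

lemma diff_cases:
  assumes "x \<in> insert 0 R"
  obtains "x = 0" | "x \<in> \<Phi>" | "-x \<in> \<Phi>" | "x \<in> \<Psi> \<or> -x \<in> \<Psi>"
  using assms R_iff by auto

section \<open>Equivalence classes of the graph and sums of their elements\<close>

definition edges :: "('a \<times> 'a) set" where
  "edges = {(x, y). x \<in> \<Phi> \<and> y \<in> \<Phi> \<and> (x - y \<in> \<Psi> \<or> y - x \<in> \<Psi>)}"

definition sim :: "'a \<Rightarrow> 'a \<Rightarrow> bool" (infix "\<doteq>" 50) where
  "x \<doteq> y \<longleftrightarrow> (x, y) \<in> edges\<^sup>*"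

lemma edges_Phi: "(x, y) \<in> edges \<Longrightarrow> x \<in> \<Phi> \<and> y \<in> \<Phi>"
  by (simp add: edges_def)

lemma sym_edges: "sym edges"
  by (auto simp: sym_def edges_def)

lemma sim_refl [simp]: "x \<doteq> x"
  by (simp add: sim_def)

lemma sim_sym: "x \<doteq> y \<Longrightarrow> y \<doteq> x"
  using sym_edges by (simp add: sim_def sym_rtrancl symD)

lemma sim_trans [trans]: "\<lbrakk>x \<doteq> y; y \<doteq> z\<rbrakk> \<Longrightarrow> x \<doteq> z"
  by (simp add: sim_def)

definition cl :: "'a \<Rightarrow> 'a set" where
  "cl x = {y. x \<doteq> y}"

lemma sim_iff: "x \<doteq> y \<longleftrightarrow> cl x = cl y"
proof
  assume xy: "x \<doteq> y"
  show "cl x = cl y"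
    unfolding cl_def using sim_trans[OF xy] sim_trans[OF sim_sym[OF xy]] by auto
next
  assume "cl x = cl y"
  then have "y \<in> cl x" by (simp add: cl_def)
  then show "x \<doteq> y" by (simp add: cl_def)
qed

lemma edge_sim: "(x, y) \<in> edges \<Longrightarrow> x \<doteq> y"
  by (simp add: sim_def)

lemma sim_Phi: "\<lbrakk>x \<doteq> y; x \<in> \<Phi>\<rbrakk> \<Longrightarrow> y \<in> \<Phi>"
  unfolding sim_def by (induction rule: rtrancl_induct) (auto simp: edges_def)

lemma edgeI: "\<lbrakk>x \<in> \<Phi>; y \<in> \<Phi>; x - y \<in> \<Psi> \<or> y - x \<in> \<Psi>\<rbrakk> \<Longrightarrow> (x, y) \<in> edges"
  by (simp add: edges_def)

text \<open>If \<open>-(x + d)\<close> were in \<Phi>, its sum with \<open>x\<close> would be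
  \<open>-d\<close>, and closedness would put \<open>-d\<close> into \<Phi>.\<close>

lemma shift_cases:
  assumes x: "x \<in> \<Phi>" and d: "d \<in> \<Psi> \<or> -d \<in> \<Psi>" and r: "x + d \<in> insert 0 R"
  shows "x + d \<in> \<Phi> \<or> x + d \<in> \<Psi> \<or> -(x + d) \<in> \<Psi>"
proof -
  have "x + d \<noteq> 0" using x d disjoint pos[of x] by (metis Un_iff add.inverse_inverse add_eq_0_iff)
  moreover have "-(x + d) \<notin> \<Phi>"
  proof
    assume a: "-(x + d) \<in> \<Phi>"
    have e: "x + -(x + d) = -d" by simp
    have "-d \<in> R" using d R_iff by auto
    then have "-d \<in> \<Phi>" using closed_Phi[OF x a] unfolding e by simp
    then show False using d disjoint pos by (metis UnI1 UnI2 add.inverse_inverse)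
  qed
  ultimately show ?thesis using r R_iff by auto
qed

text \<open>With \<open>d = a1 - a\<close>, \<open>jacobi\<close> is applied to \<open>a1\<close>,
  \<open>-d\<close> and \<open>b\<close>. Either the sum follows the step, or the other summand
  compensates for it; if the compensated summand leaves \<Phi>, it lies in \<Psi> up to sign and is
  itself an edge from \<open>a + b\<close> to \<open>a1\<close>.\<close>

lemma edge_summand:
  assumes "a \<in> \<Phi>" "b \<in> \<Phi>" "a + b \<in> R" and e: "(a, a1) \<in> edges"
  shows "(a1 + b \<in> \<Phi> \<and> (a + b, a1 + b) \<in> edges) \<or> (a + b - a1 \<in> \<Phi> \<and> (b, a + b - a1) \<in> edges)
     \<or> (a + b, a1) \<in> edges"
proof -
  define d where "d = a1 - a"
  have d: "d \<in> \<Psi> \<or> -d \<in> \<Psi>" and a1: "a1 \<in> \<Phi>" using e by (auto simp: edges_def d_def)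
  have dR: "-d \<in> R" using d R_iff by auto
  have ab: "a + b \<in> \<Phi>" using assms closed_Phi by blast
  have "a1 + -d = a" by (simp add: d_def)
  then consider "a1 + b \<in> insert 0 R" | "-d + b \<in> insert 0 R"
    using jacobi[of a1 "-d" b] assms a1 dR Phi_R by auto
  then show ?thesis
  proof cases
    case 1
    then have "a1 + b \<in> \<Phi>" using add_nonzero[of a1 b] closed_Phi assms a1 by auto
    moreover have "(a + b, a1 + b) \<in> edges"
      using calculation ab d by (intro edgeI) (auto simp: d_def)
    ultimately show ?thesis by simp
  next
    case 2
    have e2: "b + -d = a + b - a1" by (simp add: d_def)
    have "a + b - a1 \<in> \<Phi> \<or> a + b - a1 \<in> \<Psi> \<or> -(a + b - a1) \<in> \<Psi>"
      using shift_cases[of b "-d"] 2 d assms(2) unfolding e2[symmetric] by (auto simp: add.commute)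
    then show ?thesis
    proof (elim disjE)
      assume "a + b - a1 \<in> \<Phi>"
      moreover have "(b, a + b - a1) \<in> edges"
        using calculation d assms(2) by (intro edgeI) (auto simp: d_def)
      ultimately show ?thesis by simp
    qed (use ab a1 in \<open>auto intro!: edgeI\<close>)
  qed
qed

text \<open>By \<open>jacobi\<close> one summand can take up the step \<open>d\<close>. If the
  adjusted summand leaves \<Phi>, it lies in \<Psi> up to sign and joins \<open>g\<close> to the
  other summand.\<close>

lemma edge_sum:
  assumes "a \<in> \<Phi>" "b \<in> \<Phi>" "a + b \<in> R" and e: "(a + b, g) \<in> edges"
  shows "(g - b \<in> \<Phi> \<and> (a, g - b) \<in> edges) \<or> (g - a \<in> \<Phi> \<and> (b, g - a) \<in> edges)
     \<or> (a, g) \<in> edges \<or> (b, g) \<in> edges"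
proof -
  define d where "d = g - (a + b)"
  have d: "d \<in> \<Psi> \<or> -d \<in> \<Psi>" and g: "g \<in> \<Phi>" using e by (auto simp: edges_def d_def)
  have dR: "d \<in> R" using d R_iff by auto
  have gd: "a + b + d = g" "a + d = g - b" "b + d = g - a" by (simp_all add: d_def algebra_simps)
  then consider "a + d \<in> insert 0 R" | "b + d \<in> insert 0 R"
    using jacobi[of a b d] assms dR Phi_R g by auto
  then show ?thesis
  proof cases
    case 1
    then consider "g - b \<in> \<Phi>" | "g - b \<in> \<Psi> \<or> b - g \<in> \<Psi>"
      using shift_cases[OF assms(1) d] unfolding gd by auto
    then show ?thesis
    proof cases
      case 1
      then have "(a, g - b) \<in> edges"
        using d assms(1) by (intro edgeI) (auto simp: d_def algebra_simps)
      then show ?thesis using 1 by simp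
    qed (use g assms in \<open>auto intro!: edgeI\<close>)
  next
    case 2
    then consider "g - a \<in> \<Phi>" | "g - a \<in> \<Psi> \<or> a - g \<in> \<Psi>"
      using shift_cases[OF assms(2) d] unfolding gd by auto
    then show ?thesis
    proof cases
      case 1
      then have "(b, g - a) \<in> edges"
        using d assms(2) by (intro edgeI) (auto simp: d_def algebra_simps)
      then show ?thesis using 1 by simp
    qed (use g assms in \<open>auto intro!: edgeI\<close>)
  qed
qed

text \<open>Pairs move inside their classes with the class of the sum fixed. The last alternative of
  \<open>edge_summand\<close> would put the sum into the class of the moved coordinate. Since
  \<open>exchange_equal_sums\<close> prescribes steps of first coordinates in \<open>T1\<close> and
  of second ones in \<open>T2\<close>, the exceptions concern \<open>a\<close> and \<open>b'\<close>
  only.\<close>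

lemma sum_sim:
  assumes Phi: "a \<in> \<Phi>" "b \<in> \<Phi>" and R: "a + b \<in> R" "a' + b' \<in> R"
    and sim: "a \<doteq> a'" "b \<doteq> b'" and neq: "\<not> a + b \<doteq> a' + b'"
  shows "a + b \<doteq> a \<or> a' + b' \<doteq> b'"
proof (rule ccontr)
  assume *: "\<not> ?thesis"
  have Phi': "a' \<in> \<Phi>" "b' \<in> \<Phi>" using Phi sim sim_Phi by auto
  define T1 where "T1 = {(x, y). a \<doteq> x \<and> b \<doteq> y \<and> a + b \<doteq> x + y}"
  define T2 where "T2 = {(x, y). a' \<doteq> x \<and> b' \<doteq> y \<and> a' + b' \<doteq> x + y}"
  have ab: "a + b \<in> \<Phi>" "a' + b' \<in> \<Phi>" using closed_Phi Phi Phi' R by auto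
  have T1: "x \<in> \<Phi> \<and> y \<in> \<Phi> \<and> x + y \<in> R" if "(x, y) \<in> T1" for x y
    using that Phi ab sim_Phi Phi_R unfolding T1_def by blast
  have T2: "x \<in> \<Phi> \<and> y \<in> \<Phi> \<and> x + y \<in> R" if "(x, y) \<in> T2" for x y
    using that Phi' ab sim_Phi Phi_R unfolding T2_def by blast
  have "\<exists>(x, y)\<in>T1. \<exists>(x', y')\<in>T2. x + y = x' + y'"
  proof (rule exchange_equal_sums[of T2 edges edges T1 a b a' b'])
    have "fst ` T2 \<subseteq> \<Phi>" using T2 by auto
    then show "finite (fst ` T2)" using finite_Phi finite_subset by blast
    show "(x1, y) \<in> T1 \<or> (x1, x + y - x1) \<in> T1 \<and> (y, x + y - x1) \<in> edges"
      if t: "(x, y) \<in> T1" and e: "(x, x1) \<in> edges" for x y x1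
    proof -
      have s: "a \<doteq> x" "b \<doteq> y" "a + b \<doteq> x + y" using t by (auto simp: T1_def)
      have "\<not> (x + y, x1) \<in> edges"
        using edge_sim[OF e] edge_sim[of "x + y" x1] s * unfolding sim_iff by auto
      then show ?thesis
        using edge_summand[of x y x1] T1[OF t] e s unfolding T1_def
        by (auto dest: edge_sim intro: sim_trans)
    qed
    show "(x, y1) \<in> T2 \<or> (x + y - y1, y1) \<in> T2 \<and> (x, x + y - y1) \<in> edges"
      if t: "(x, y) \<in> T2" and e: "(y, y1) \<in> edges" for x y y1
    proof -
      have s: "a' \<doteq> x" "b' \<doteq> y" "a' + b' \<doteq> y + x" using t by (auto simp: T2_def add.commute)
      have "\<not> (y + x, y1) \<in> edges"
        using edge_sim[OF e] edge_sim[of "y + x" y1] s * unfolding sim_iff by (auto simp: add.commute)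
      then show ?thesis
        using edge_summand[of y x y1] T2[OF t] e s unfolding T2_def
        by (auto dest: edge_sim intro: sim_trans simp: add.commute)
    qed
  qed (use sim sym_edges in \<open>auto simp: T1_def T2_def sim_def\<close>)
  then show False using neq unfolding T1_def T2_def by (auto simp: sim_iff)
qed

lemma rtrancl_uminus: "(x, y) \<in> r\<^sup>* \<Longrightarrow> (-x, -y) \<in> {(u :: 'a, v). (-u, -v) \<in> r}\<^sup>*"
proof (induction rule: rtrancl_induct)
  case (step y z)
  then have "(-y, -z) \<in> {(u, v). (-u, -v) \<in> r}" by simp
  then show ?case using step by (meson rtrancl.rtrancl_into_rtrancl)
qed simp

text \<open>The pair \<open>(a, -(a + b))\<close> has sum \<open>-b\<close>, so the argument for
  sums also compares differences. The negated second coordinates are the reason for the relation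
  \<open>E\<close>.\<close>

lemma cancel_aux:
  assumes Phi: "a \<in> \<Phi>" "b \<in> \<Phi>" "a' \<in> \<Phi>" "b' \<in> \<Phi>" and R: "a + b \<in> R" "a' + b' \<in> R"
    and sim: "a \<doteq> a'" "a + b \<doteq> a' + b'" and neq: "\<not> a + b \<doteq> a" "\<not> a' + b' \<doteq> b'"
  shows "b \<doteq> b'"
proof -
  define T1 where "T1 = {(x, y). a \<doteq> x \<and> a + b \<doteq> -y \<and> b \<doteq> -(x + y)}"
  define T2 where "T2 = {(x, y). a' \<doteq> x \<and> a' + b' \<doteq> -y \<and> b' \<doteq> -(x + y)}"
  define E where "E = {(u, v). (-u, -v) \<in> edges}"
  have ab: "a + b \<in> \<Phi>" "a' + b' \<in> \<Phi>" using closed_Phi Phi R by auto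
  have T1: "x \<in> \<Phi> \<and> -(x + y) \<in> \<Phi> \<and> -y \<in> R" if "(x, y) \<in> T1" for x y
    using that Phi ab sim_Phi Phi_R unfolding T1_def by blast
  have T2: "x \<in> \<Phi> \<and> -(x + y) \<in> \<Phi> \<and> -y \<in> R" if "(x, y) \<in> T2" for x y
    using that Phi ab sim_Phi Phi_R unfolding T2_def by blast
  have "\<exists>(x, y)\<in>T1. \<exists>(x', y')\<in>T2. x + y = x' + y'"
  proof (rule exchange_equal_sums[of T2 edges E T1 a "-(a + b)" a' "-(a' + b')"])
    have "fst ` T2 \<subseteq> \<Phi>" using T2 by auto
    then show "finite (fst ` T2)" using finite_Phi finite_subset by blast
    show "sym E" using sym_edges by (auto simp: sym_def E_def)
    show "(x1, y) \<in> T1 \<or> (x1, x + y - x1) \<in> T1 \<and> (y, x + y - x1) \<in> E"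
      if t: "(x, y) \<in> T1" and e: "(x, x1) \<in> edges" for x y x1
    proof -
      have s: "a \<doteq> x" "a + b \<doteq> -y" "b \<doteq> -(x + y)" using t by (auto simp: T1_def)
      have xx1: "x \<doteq> x1" using e by (rule edge_sim)
      have "(-y, x1) \<notin> edges"
      proof
        assume "(-y, x1) \<in> edges"
        then have "-y \<doteq> x1" by (rule edge_sim)
        then show False using s xx1 neq(1) unfolding sim_iff by simp
      qed
      moreover have eqs: "x + -(x + y) = -y" "x1 + -(x + y) = x1 - (x + y)" by simp_all
      ultimately consider "(-y, x1 - (x + y)) \<in> edges" | "(-(x + y), - y - x1) \<in> edges"
        using edge_summand[of x "-(x + y)" x1, unfolded eqs] T1[OF t] e by blast
      then show ?thesis
      proof cases
        case 1
        have "a + b \<doteq> -(x + y - x1)" using sim_trans[OF s(2) edge_sim[OF 1]] by simp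
        then have "(x1, x + y - x1) \<in> T1" using s sim_trans[OF s(1) xx1] by (simp add: T1_def)
        then show ?thesis using 1 by (simp add: E_def)
      next
        case 2
        have "b \<doteq> -(x1 + y)" using sim_trans[OF s(3) edge_sim[OF 2]] by (simp add: minus_diff_commute)
        then have "(x1, y) \<in> T1" using s sim_trans[OF s(1) xx1] by (simp add: T1_def)
        then show ?thesis by simp
      qed
    qed
    show "(x, y1) \<in> T2 \<or> (x + y - y1, y1) \<in> T2 \<and> (x, x + y - y1) \<in> edges"
      if t: "(x, y) \<in> T2" and e: "(y, y1) \<in> E" for x y y1
    proof -
      have s: "a' \<doteq> x" "a' + b' \<doteq> -y" "b' \<doteq> -(x + y)" using t by (auto simp: T2_def)
      have e': "(-y, -y1) \<in> edges" using e by (simp add: E_def)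
      have yy1: "-y \<doteq> -y1" using e' by (rule edge_sim)
      have "(x, -y1) \<notin> edges"
      proof
        assume "(x, -y1) \<in> edges"
        then have "x \<doteq> -y1" by (rule edge_sim)
        then show False using s yy1 neq(1) sim unfolding sim_iff by simp
      qed
      moreover have "(-(x + y), -y1) \<notin> edges"
      proof
        assume "(-(x + y), -y1) \<in> edges"
        then have "-(x + y) \<doteq> -y1" by (rule edge_sim)
        then show False using s yy1 neq(2) unfolding sim_iff by simp
      qed
      moreover have eqs: "x + -(x + y) = -y" "-y1 - -(x + y) = x + y - y1" by simp_all
      ultimately consider "(x, x + y - y1) \<in> edges" | "(-(x + y), - y1 - x) \<in> edges"
        using edge_sum[of x "-(x + y)" "-y1", unfolded eqs] T2[OF t] e' by blast
      then show ?thesis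
      proof cases
        case 1
        have "(x + y - y1, y1) \<in> T2"
          using s sim_trans[OF s(1) edge_sim[OF 1]] sim_trans[OF s(2) yy1] by (simp add: T2_def)
        then show ?thesis using 1 by simp
      next
        case 2
        have "b' \<doteq> -(x + y1)" using sim_trans[OF s(3) edge_sim[OF 2]] by (simp add: minus_diff_commute)
        then have "(x, y1) \<in> T2" using s sim_trans[OF s(2) yy1] by (simp add: T2_def)
        then show ?thesis by simp
      qed
    qed
    show "(-(a + b), -(a' + b')) \<in> E\<^sup>*"
      using rtrancl_uminus[of "a + b" "a' + b'" edges] sim unfolding E_def sim_def by simp
  qed (use sim sym_edges in \<open>auto simp: T1_def T2_def sim_def add.commute\<close>)
  then obtain x y x' y' where xy: "(x, y) \<in> T1" "(x', y') \<in> T2" "x + y = x' + y'" by blast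
  have "b \<doteq> -(x + y)" using xy(1) unfolding T1_def by simp
  moreover have "b' \<doteq> -(x' + y')" using xy(2) unfolding T2_def by simp
  ultimately show ?thesis using xy(3) sim_sym sim_trans by metis
qed

text \<open>Were \<open>b\<close> and \<open>b'\<close> inequivalent, \<open>cancel_aux\<close> used
  in both directions would put each of them into the common class of the two sums.\<close>

lemma cancel:
  assumes Phi: "a \<in> \<Phi>" "b \<in> \<Phi>" "a' \<in> \<Phi>" "b' \<in> \<Phi>" and R: "a + b \<in> R" "a' + b' \<in> R"
    and sim: "a \<doteq> a'" "a + b \<doteq> a' + b'" and neq: "\<not> a + b \<doteq> a"
  shows "b \<doteq> b'"
proof (rule ccontr)
  assume *: "\<not> ?thesis"
  have "a' + b' \<doteq> b'" using cancel_aux[OF Phi R sim neq] * by blast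
  moreover have "a + b \<doteq> b"
    using cancel_aux[of a' b' a b] Phi R sim neq * unfolding sim_iff by auto
  ultimately show False using * sim unfolding sim_iff by simp
qed

text \<open>Along each edge \<open>edge_sum\<close> adjusts one summand within its class; its other
  alternatives would put the sum into the class of a summand.\<close>

lemma sim_split:
  assumes "a \<in> \<Phi>" "b \<in> \<Phi>" "a + b \<in> R" "\<not> a + b \<doteq> a" "\<not> a + b \<doteq> b" and "a + b \<doteq> g"
  shows "\<exists>x y. g = x + y \<and> a \<doteq> x \<and> b \<doteq> y"
  using assms(6) unfolding sim_def
proof (induction rule: rtrancl_induct)
  case base
  then show ?case by blast
next
  case (step g g')
  then obtain x y where xy: "g = x + y" "a \<doteq> x" "b \<doteq> y" unfolding sim_def by blast
  have s: "a + b \<doteq> g" "a + b \<doteq> g'" using step by (auto simp: sim_def)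
  have P: "x \<in> \<Phi>" "y \<in> \<Phi>" "x + y \<in> R"
    using sim_Phi[OF xy(2) assms(1)] sim_Phi[OF xy(3) assms(2)] edges_Phi[OF step(2)] xy(1) Phi_R by simp_all
  have "\<not> (x, g') \<in> edges" "\<not> (y, g') \<in> edges"
    using s xy assms edge_sim[of x g'] edge_sim[of y g'] unfolding sim_iff by auto
  then consider "(x, g' - y) \<in> edges" | "(y, g' - x) \<in> edges"
    using edge_sum[of x y g'] P step xy by auto
  then show ?case
  proof cases
    case 1
    have "a \<doteq> g' - y" using sim_trans[OF xy(2) edge_sim[OF 1]] .
    then show ?thesis using xy unfolding sim_def by (intro exI[of _ "g' - y"] exI[of _ y]) simp
  next
    case 2
    have "b \<doteq> g' - x" using sim_trans[OF xy(3) edge_sim[OF 2]] .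
    then show ?thesis using xy unfolding sim_def by (intro exI[of _ x] exI[of _ "g' - x"]) simp
  qed
qed

section \<open>Indecomposable classes and what they generate\<close>

definition indec :: "'a \<Rightarrow> bool" where
  "indec a \<longleftrightarrow> a \<in> \<Phi> \<and> (\<forall>x\<in>\<Phi>. \<forall>y\<in>\<Phi>. x + y \<doteq> a \<longrightarrow> x \<doteq> a \<or> y \<doteq> a)"

lemma indecD: "\<lbrakk>indec a; x \<in> \<Phi>; y \<in> \<Phi>; x + y \<doteq> a\<rbrakk> \<Longrightarrow> x \<doteq> a \<or> y \<doteq> a"
  by (auto simp: indec_def)

text \<open>\<open>sim_split\<close> carries a decomposition of any equivalent element to one of
  \<open>a\<close> itself.\<close>

lemma indecI:
  assumes "a \<in> \<Phi>" and "\<And>x y. \<lbrakk>x \<in> \<Phi>; y \<in> \<Phi>\<rbrakk> \<Longrightarrow> x + y \<noteq> a"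
  shows "indec a"
  unfolding indec_def
proof (intro conjI ballI impI)
  fix x y assume xy: "x \<in> \<Phi>" "y \<in> \<Phi>" "x + y \<doteq> a"
  show "x \<doteq> a \<or> y \<doteq> a"
  proof (rule ccontr)
    assume n: "\<not> ?thesis"
    have "x + y \<in> R" using sim_Phi[OF sim_sym[OF xy(3)] assms(1)] by (rule Phi_R)
    then obtain x' y' where "a = x' + y'" "x \<doteq> x'" "y \<doteq> y'"
      using sim_split[of x y a] xy n unfolding sim_iff by blast
    then show False using assms(2)[of x' y'] xy sim_Phi by blast
  qed
qed (rule assms(1))

text \<open>The union of the multiples of the component of \<open>a\<close>. A sum that stays in the
  class of \<open>k\<close> or of \<open>y\<close> adds nothing new, so \<open>step\<close> may
  admit it.\<close>

inductive_set gen :: "'a \<Rightarrow> 'a set" for a where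
  base: "a \<doteq> x \<Longrightarrow> x \<in> gen a"
| step: "\<lbrakk>k \<in> gen a; a \<doteq> y; k + y \<in> R; k + y \<doteq> x\<rbrakk> \<Longrightarrow> x \<in> gen a"

lemma gen_sim: "\<lbrakk>x \<in> gen a; x \<doteq> y\<rbrakk> \<Longrightarrow> y \<in> gen a"
  by (erule gen.cases) (blast intro: gen.intros sim_trans)+

lemma gen_Phi: "x \<in> gen a \<Longrightarrow> a \<in> \<Phi> \<Longrightarrow> x \<in> \<Phi>"
  by (induction rule: gen.induct) (blast intro: sim_Phi closed_Phi)+

text \<open>The rule \<open>step\<close> gives only something equivalent to a sum;
  \<open>sim_split\<close> makes it an actual sum. Proving the claim for the whole class of
  \<open>x\<close> handles sums that stay in the class of \<open>k\<close>.\<close>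

lemma gen_cases:
  assumes "a \<in> \<Phi>" "x \<in> gen a"
  obtains "a \<doteq> x" | k y where "k \<in> gen a" "a \<doteq> y" "x = k + y"
proof -
  have "a \<doteq> x' \<or> (\<exists>k y. k \<in> gen a \<and> a \<doteq> y \<and> x' = k + y)" if "x \<doteq> x'" for x'
    using assms(2) that
  proof (induction arbitrary: x' rule: gen.induct)
    case (base x)
    then show ?case using sim_trans by blast
  next
    case (step k y x)
    have P: "k \<in> \<Phi>" "y \<in> \<Phi>" using step.hyps assms gen_Phi sim_Phi by blast+
    have x': "k + y \<doteq> x'" using step.hyps(4) step.prems by (rule sim_trans)
    consider "k + y \<doteq> k" | "k + y \<doteq> y" | "\<not> k + y \<doteq> k" "\<not> k + y \<doteq> y" by blast
    then show ?case
    proof cases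
      case 1
      then have "k \<doteq> x'" using x' unfolding sim_iff by simp
      then show ?thesis by (rule step.IH)
    next
      case 2
      then have "a \<doteq> x'" using x' step.hyps(2) unfolding sim_iff by simp
      then show ?thesis by simp
    next
      case 3
      then obtain u v where "x' = u + v" "k \<doteq> u" "y \<doteq> v"
        using sim_split[of k y x'] P step.hyps(3) x' by blast
      then show ?thesis using step.hyps gen_sim sim_trans by blast
    qed
  qed
  from this[OF sim_refl] show ?thesis using that by blast
qed

text \<open>Induction on the generation of \<open>k\<close>. When it splits as \<open>u + v\<close>
  with \<open>v\<close> equivalent to \<open>a\<close>, \<open>jacobi\<close> lets \<open>j\<close>
  absorb the two parts in one of the two orders: \<open>u\<close> by induction, \<open>v\<close> by
  \<open>gen.step\<close>.\<close>

lemma gen_add: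
  assumes a: "a \<in> \<Phi>" and j: "j \<in> gen a" and k: "k \<in> gen a" and R: "j + k \<in> R"
  shows "j + k \<in> gen a"
proof -
  have "j + k' \<in> gen a" if "k \<doteq> k'" "j \<in> gen a" "j + k' \<in> R" for j k'
    using k that
  proof (induction arbitrary: j k' rule: gen.induct)
    case (base x)
    then show ?case using gen.step[OF _ sim_trans[OF base(1,2)]] sim_refl by blast
  next
    case (step k y x)
    have P: "k \<in> \<Phi>" "y \<in> \<Phi>" "j \<in> \<Phi>" using step.hyps step.prems a gen_Phi sim_Phi by blast+
    have s: "k + y \<doteq> k'" using step.hyps(4) step.prems(1) by (rule sim_trans)
    consider "k \<doteq> k'" | "y \<doteq> k'" | "\<not> k + y \<doteq> k" "\<not> k + y \<doteq> y"
      using s unfolding sim_iff by metis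
    then show ?case
    proof cases
      case 1
      then show ?thesis using step by blast
    next
      case 2
      then show ?thesis
        using gen.step[OF step.prems(2) sim_trans[OF step.hyps(2) 2] step.prems(3)] by simp
    next
      case 3
      then obtain u v where uv: "k' = u + v" "k \<doteq> u" "y \<doteq> v"
        using sim_split[OF P(1,2) step.hyps(3) _ _ s] by blast
      have P': "u \<in> \<Phi>" "v \<in> \<Phi>" using uv P sim_Phi by blast+
      have av: "a \<doteq> v" using step.hyps(2) uv(3) by (rule sim_trans)
      have "u + v \<in> R" using sim_Phi[OF s closed_Phi[OF P(1,2) step.hyps(3)]] uv Phi_R by simp
      moreover have "u + v + j \<in> R" using step.prems(3) uv by (simp add: algebra_simps)
      ultimately have "u + j \<in> R \<or> v + j \<in> R"
        using jacobi[of u v j] P' P Phi_R add_nonzero[of u j] add_nonzero[of v j] by blast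
      then show ?thesis
      proof
        assume "u + j \<in> R"
        then have "j + u \<in> gen a" using step.IH[OF uv(2) step.prems(2)] by (simp add: add.commute)
        then show ?thesis
          using gen.step[of "j + u" a v k'] av step.prems(3) uv by (simp add: algebra_simps gen.step)
      next
        assume vj: "v + j \<in> R"
        then have "j + v \<in> gen a" using gen.step[OF step.prems(2) av] by (simp add: add.commute)
        then show ?thesis
          using step.IH[OF uv(2), of "j + v"] step.prems(3) uv by (simp add: algebra_simps)
      qed
    qed
  qed
  from this[OF sim_refl j R] show ?thesis .
qed

text \<open>Induction on the generation of the sum. Once it is written as \<open>d + v\<close> with
  \<open>v\<close> equivalent to \<open>a\<close>, \<open>refine\<close> makes \<open>v\<close>
  comparable to one of the two outside summands.\<close>

lemma gen_prime:
  assumes a: "indec a" and x: "x \<in> \<Phi> - gen a" and y: "y \<in> \<Phi> - gen a"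
  shows "x + y \<notin> gen a"
proof
  have aP: "a \<in> \<Phi>" using a by (simp add: indec_def)
  \<comment> \<open>If \<open>u - p\<close> is in \<Phi>, indecomposability puts it into the class
    of \<open>a\<close>, and \<open>q = d + (u - p)\<close> is generated. If \<open>p - u\<close> is
    in \<Phi>, either \<open>p\<close> is generated or \<open>d = (p - u) + q\<close> contradicts
    the induction hypothesis for \<open>d\<close>.\<close>
  have exchange: False
    if d: "d \<in> gen a" "\<And>p q. \<lbrakk>p \<in> \<Phi> - gen a; q \<in> \<Phi> - gen a\<rbrakk> \<Longrightarrow> d \<noteq> p + q"
      and u: "a \<doteq> u" and p: "p \<in> \<Phi> - gen a" and q: "q \<in> \<Phi> - gen a"
      and eq: "d + u = p + q" and r: "u - p \<in> insert 0 R" for d u p q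
  proof -
    have uP: "u \<in> \<Phi>" and ug: "u \<in> gen a" using u aP sim_Phi gen.base by blast+
    from r show False
    proof (cases rule: diff_cases)
      case 1
      then show False using p ug by simp
    next
      case 2
      have "(u - p) + p \<doteq> a" using sim_sym[OF u] by simp
      then have "u - p \<doteq> a \<or> p \<doteq> a" using indecD[OF a 2] p by blast
      then have *: "a \<doteq> u - p" using p gen.base sim_sym by blast
      have "d + (u - p) = q" using eq by (simp add: algebra_simps)
      then show False using gen.step[OF d(1) *] q Phi_R by auto
    next
      case 3
      then have 3: "p - u \<in> \<Phi>" by simp
      show False
      proof (cases "p - u \<in> gen a")
        case True
        then show False using gen.step[OF True u, of p] p Phi_R by auto
      next
        case False
        moreover have "d = (p - u) + q" using eq by (simp add: algebra_simps)
        ultimately show False using d(2)[of "p - u" q] 3 q by blast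
      qed
    next
      case 4
      then have "(u, p) \<in> edges" using uP p by (intro edgeI) auto
      then show False using gen_sim[OF ug edge_sim] p by blast
    qed
  qed
  have key: "z' \<noteq> x + y" if "z \<in> gen a" "z \<doteq> z'" "x \<in> \<Phi> - gen a" "y \<in> \<Phi> - gen a" for z z' x y
    using that
  proof (induction arbitrary: z' x y rule: gen.induct)
    case (base z)
    show ?case
    proof
      assume "z' = x + y"
      then have "x + y \<doteq> a" using sim_sym[OF sim_trans[OF base(1,2)]] by simp
      then have "x \<doteq> a \<or> y \<doteq> a" using indecD[OF a] base by blast
      then show False using base gen.base sim_sym by blast
    qed
  next
    case (step k u z)
    have P: "k \<in> \<Phi>" "u \<in> \<Phi>" using step.hyps aP gen_Phi sim_Phi by blast+
    have s: "k + u \<doteq> z'" using step.hyps(4) step.prems(1) by (rule sim_trans)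
    consider "k \<doteq> z'" | "u \<doteq> z'" | "\<not> k + u \<doteq> k" "\<not> k + u \<doteq> u"
      using s unfolding sim_iff by metis
    then show ?case
    proof cases
      case 1
      then show ?thesis using step by blast
    next
      case 2
      have az: "a \<doteq> z'" using step.hyps(2) 2 by (rule sim_trans)
      show ?thesis
      proof
        assume "z' = x + y"
        then have "x + y \<doteq> a" using sim_sym[OF az] by simp
        then have "x \<doteq> a \<or> y \<doteq> a" using indecD[OF a] step.prems by blast
        then show False using step.prems gen.base sim_sym by blast
      qed
    next
      case 3
      then obtain d v where dv: "z' = d + v" "k \<doteq> d" "u \<doteq> v"
        using sim_split[OF P step.hyps(3) _ _ s] by blast
      have dg: "d \<in> gen a" using gen_sim[OF step.hyps(1) dv(2)] .
      have av: "a \<doteq> v" using step.hyps(2) dv(3) by (rule sim_trans)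
      have P': "d \<in> R" "v \<in> R" "x \<in> R" "y \<in> R"
        using dg av step.prems aP gen_Phi sim_Phi Phi_R by blast+
      note ih = step.IH[OF dv(2)]
      show ?thesis
      proof
        assume z': "z' = x + y"
        have nz: "v + d \<noteq> 0" using add_nonzero[of v d] dg av aP gen_Phi sim_Phi by blast
        have eq: "d + v = x + y" using z' dv by simp
        have "v - x \<in> insert 0 R \<or> v - y \<in> insert 0 R"
          using refine[of v d x y] P' nz eq by (simp add: add.commute)
        then show False
        proof
          assume "v - x \<in> insert 0 R"
          then show False using exchange[OF dg ih av step.prems(2,3) eq] by blast
        next
          assume r: "v - y \<in> insert 0 R"
          have "d + v = y + x" using eq by (simp add: add.commute)
          then show False using exchange[OF dg ih av step.prems(3,2) _ r] by blast
        qed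
      qed
    qed
  qed
  assume "x + y \<in> gen a"
  from key[OF this sim_refl x y] show False by simp
qed

text \<open>\<open>gen_cases\<close> supplies one decomposition with a generated remainder, and
  \<open>cancel\<close> makes \<open>k\<close> equivalent to that remainder.\<close>

lemma gen_sum:
  assumes "a \<in> \<Phi>" "x \<in> gen a" "\<not> a \<doteq> x" "x = k + y" "a \<doteq> y" "k \<in> \<Phi>"
  shows "k \<in> gen a"
proof -
  obtain j u where ju: "j \<in> gen a" "a \<doteq> u" "x = j + u"
    using gen_cases[OF assms(1,2)] assms(3) by blast
  have P: "y \<in> \<Phi>" "u \<in> \<Phi>" "j \<in> \<Phi>" "x \<in> R"
    using assms ju sim_Phi gen_Phi Phi_R by blast+
  have eqs: "u + j = x" "y + k = x" using assms(4) ju(3) by (simp_all add: add.commute)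
  have "j \<doteq> k"
  proof (rule cancel[of u j y k])
    show "u \<doteq> y" using sim_trans[OF sim_sym[OF ju(2)] assms(5)] .
    show "\<not> u + j \<doteq> u" unfolding eqs using assms(3) ju(2) sim_trans sim_sym by blast
  qed (use P assms(6) in \<open>simp_all add: eqs\<close>)
  then show ?thesis using gen_sim ju(1) by blast
qed

text \<open>Changing the sign of the part \<open>K\<close> passes to another positive system. It turns the difference of an
  element of \<open>K\<close> and one of \<open>\<Phi> - K\<close> into a sum, so that facts about sums apply to differences.\<close>

lemma twist:
  assumes K: "K \<subseteq> \<Phi>" and sat: "\<And>x y. \<lbrakk>x \<in> K; x \<doteq> y\<rbrakk> \<Longrightarrow> y \<in> K"
    and add: "\<And>x y. \<lbrakk>x \<in> K; y \<in> K; x + y \<in> R\<rbrakk> \<Longrightarrow> x + y \<in> K"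
    and prime: "\<And>x y. \<lbrakk>x \<in> \<Phi> - K; y \<in> \<Phi> - K\<rbrakk> \<Longrightarrow> x + y \<notin> K"
  shows "root_partition R ((\<Phi> - K) \<union> uminus ` K) \<Psi>"
proof -
  have neg: "x \<in> uminus ` K \<longleftrightarrow> -x \<in> K" for x by (auto intro: image_eqI[of _ _ "-x"])
  \<comment> \<open>This closes the new set under sums of a negated and an unchanged element. A
    difference in \<Psi> up to sign would be an edge leaving the saturated set
    \<open>K\<close>.\<close>
  have mixed: "k - l \<in> K \<or> l - k \<in> \<Phi> - K" if k: "k \<in> K" and l: "l \<in> \<Phi> - K" and r: "k - l \<in> R" for k l
  proof -
    have kl: "k \<in> \<Phi>" "l \<in> \<Phi>" using k l K by auto
    have e: "(k, l) \<notin> edges" using sat[OF k edge_sim] l by blast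
    from r have "k - l \<in> insert 0 R" by simp
    then show ?thesis
    proof (cases rule: diff_cases)
      case 1 then show ?thesis using r zero_notin by simp
    next
      case 2
      have "(k - l) + l \<in> K" using k by simp
      then show ?thesis using 2 prime[OF _ l] by blast
    next
      case 3
      have "l - k \<notin> K"
      proof
        assume "l - k \<in> K"
        then show False using add[OF k, of "l - k"] l Phi_R by auto
      qed
      then show ?thesis using 3 by simp
    next
      case 4 then show ?thesis using e kl edgeI by auto
    qed
  qed
  show ?thesis
  proof
    show "finite R" by (rule finite_R)
    show "\<lbrakk>x \<in> R; y \<in> R; x \<bullet> y < 0\<rbrakk> \<Longrightarrow> x + y \<in> insert 0 R" for x y by (rule add_root)
    show "x \<in> R \<longleftrightarrow> x \<in> \<Phi> - K \<union> uminus ` K \<or> x \<in> \<Psi> \<or> -x \<in> \<Phi> - K \<union> uminus ` K \<or> -x \<in> \<Psi>" for x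
      unfolding neg Un_iff Diff_iff minus_minus using R_iff[of x] K by blast
    show "x \<in> \<Phi> - K \<union> uminus ` K \<Longrightarrow> x \<notin> \<Psi>" for x
      unfolding neg Un_iff using disjoint[of x] pos[of "-x", unfolded minus_minus] K by blast
    show "x \<in> \<Phi> - K \<union> uminus ` K \<union> \<Psi> \<Longrightarrow> -x \<notin> \<Phi> - K \<union> uminus ` K \<union> \<Psi>" for x
      unfolding neg Un_iff Diff_iff minus_minus
      using disjoint[of x] disjoint[of "-x"] pos[of x] pos[of "-x", unfolded minus_minus] K by blast
    show "x + y \<in> \<Phi> - K \<union> uminus ` K"
      if x: "x \<in> \<Phi> - K \<union> uminus ` K" and y: "y \<in> \<Phi> - K \<union> uminus ` K" and r: "x + y \<in> R" for x y
    proof -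
      consider "x \<in> \<Phi> - K" "y \<in> \<Phi> - K" | "-x \<in> K" "-y \<in> K"
        | "-x \<in> K" "y \<in> \<Phi> - K" | "x \<in> \<Phi> - K" "-y \<in> K"
        using x y unfolding neg Un_iff by blast
      then show ?thesis
      proof cases
        case 1 then show ?thesis using prime closed_Phi r by blast
      next
        case 2
        have "-x + -y \<in> R" using r uminus_R[of "x + y"] by simp
        then have "-x + -y \<in> K" using add 2 by blast
        then have "-(x + y) \<in> K" by simp
        then show ?thesis unfolding neg Un_iff by blast
      next
        case 3
        have "-x - y \<in> R" using r uminus_R[of "x + y"] by simp
        then have "-x - y \<in> K \<or> y - -x \<in> \<Phi> - K" using mixed 3 by blast
        then show ?thesis unfolding neg Un_iff by (auto simp: add.commute)
      next
        case 4
        have "-y - x \<in> R" using r uminus_R[of "x + y"] by (simp add: minus_diff_commute)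
        then have "-y - x \<in> K \<or> x - -y \<in> \<Phi> - K" using mixed 4 by blast
        then show ?thesis unfolding neg Un_iff by (auto simp: minus_diff_commute)
      qed
    qed
  qed (rule closed_Psi)
qed

text \<open>After the sign change \<open>-a\<close> and \<open>-b\<close> are equivalent, and
  \<open>f - a\<close> and \<open>f - b\<close> are sums. If \<open>b - f\<close> were in
  \<open>K\<close>, these sums would be in different parts, so \<open>sum_sim\<close> would link
  \<open>f - a\<close> to \<open>-a\<close> or \<open>f - b\<close> to \<open>f\<close>. Either link
  joins the unchanged to the negated part.\<close>

lemma twist_absorb:
  assumes K: "K \<subseteq> \<Phi>" and sat: "\<And>x y. \<lbrakk>x \<in> K; x \<doteq> y\<rbrakk> \<Longrightarrow> y \<in> K"
    and add: "\<And>x y. \<lbrakk>x \<in> K; y \<in> K; x + y \<in> R\<rbrakk> \<Longrightarrow> x + y \<in> K"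
    and prime: "\<And>x y. \<lbrakk>x \<in> \<Phi> - K; y \<in> \<Phi> - K\<rbrakk> \<Longrightarrow> x + y \<notin> K"
    and f: "f \<in> \<Phi> - K" and a: "a \<in> K" "b \<in> K" "a \<doteq> b" and d: "f - a \<in> \<Phi> - K"
  shows "b - f \<notin> K"
proof
  assume bf: "b - f \<in> K"
  let ?P = "(\<Phi> - K) \<union> uminus ` K"
  interpret t: root_partition R ?P \<Psi>
    by (rule twist) (use K sat add prime in blast)+
  have neg: "x \<in> uminus ` K \<longleftrightarrow> -x \<in> K" for x
    by (auto intro: image_eqI[of _ _ "-x"])
  have K_iff: "-x \<in> K \<longleftrightarrow> -y \<in> K" if "t.sim x y" for x y
    using that unfolding t.sim_def
  proof (induction rule: rtrancl_induct)
    case (step y z)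
    have yz: "y \<in> ?P" "z \<in> ?P" "y - z \<in> \<Psi> \<or> z - y \<in> \<Psi>"
      using step(2) unfolding t.edges_def by auto
    \<comment> \<open>No edge joins the two parts: the difference of their elements is a sum of two
      elements of \<Phi>, hence in \<Phi> if it is a root.\<close>
    have no: False if "u \<in> \<Phi> - K" "-v \<in> K" "u - v \<in> \<Psi> \<or> v - u \<in> \<Psi>" for u v
    proof -
      have P: "u \<in> \<Phi>" "-v \<in> \<Phi>" using that K by auto
      have "u - v \<in> R" using that(3) R_iff[of "u - v"] by auto
      then have "u + -v \<in> \<Phi>" using closed_Phi[OF P] by simp
      then show False using that(3) disjoint[of "u - v"] pos[of "u - v"] by auto
    qed
    have "-y \<in> K \<longleftrightarrow> -z \<in> K"
      using no[of y z] no[of z y] yz unfolding Un_iff neg by blast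
    then show ?case using step by simp
  qed simp
  have ab: "t.sim (-a) (-b)"
    using a(3) unfolding sim_def
  proof (induction rule: rtrancl_induct)
    case (step y z)
    have "a \<doteq> y" "a \<doteq> z" using step(1,2) unfolding sim_def by auto
    then have "y \<in> K" "z \<in> K" using sat a by auto
    then have "(-y, -z) \<in> t.edges"
      using step(2) unfolding t.edges_def edges_def by auto
    then show ?case using step(3) t.edge_sim t.sim_trans by blast
  qed simp
  have nK: "-f \<notin> K" "-(f - a) \<notin> K"
    using f d K pos[of f] pos[of "f - a"] by auto
  have R: "f - a \<in> R" "f - b \<in> R"
    using d bf K Phi_R uminus_R[of "f - b"] by auto
  have "t.sim (-a + f) (-a) \<or> t.sim (-b + f) f"
  proof (rule t.sum_sim)
    show "\<not> t.sim (-a + f) (-b + f)" using K_iff[of "-a + f" "-b + f"] nK bf by auto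
  qed (use a f R ab in auto)
  then show False
    using K_iff[of "-a + f" "-a"] K_iff[of "-b + f" f] nK bf a by auto
qed

text \<open>Translations by elements of \<open>gen a\<close> preserve this set, whereas a simple root in it is moved to 0 by
  its own negative; so no such root occurs in the support of \<open>gen a\<close>.\<close>

definition free :: "'a \<Rightarrow> 'a set" where
  "free a = {y \<in> \<Phi> - gen a. \<forall>u. a \<doteq> u \<longrightarrow> \<not> y + u \<doteq> a}"

text \<open>Upwards, \<open>gen_sum\<close> keeps \<open>y + u\<close> out of \<open>gen a\<close>,
  and \<open>twist_absorb\<close> with \<open>f = y + u\<close> forbids a second translation into
  the class of \<open>a\<close>. Downwards, indecomposability and freeness exclude
  \<open>u - y\<close> from \<Phi>, and \<open>sum_sim\<close> compares \<open>u + (y - u)\<close>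
  with \<open>v + (y - u)\<close>.\<close>

lemma free_translate:
  assumes a: "indec a" and y: "y \<in> free a" and u: "a \<doteq> u"
  shows "y + u \<in> insert 0 R \<Longrightarrow> y + u \<in> free a" and "y - u \<in> insert 0 R \<Longrightarrow> y - u \<in> free a"
proof -
  have aP: "a \<in> \<Phi>" using a by (simp add: indec_def)
  have yP: "y \<in> \<Phi>" "y \<notin> gen a" and yfree: "\<And>u. a \<doteq> u \<Longrightarrow> \<not> y + u \<doteq> a"
    using y by (auto simp: free_def)
  have uP: "u \<in> \<Phi>" and ug: "u \<in> gen a" using u aP sim_Phi gen.base by blast+
  note genK = subsetI[OF gen_Phi[OF _ aP]] gen_sim gen_add[OF aP] gen_prime[OF a]
  show "y + u \<in> free a" if r: "y + u \<in> insert 0 R"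
  proof -
    have fR: "y + u \<in> R" using r add_nonzero[of y u] yP uP by auto
    then have fP: "y + u \<in> \<Phi>" using closed_Phi yP uP by blast
    have na: "\<not> a \<doteq> y + u" using yfree[OF u] sim_sym by blast
    have fg: "y + u \<notin> gen a"
      using gen_sum[OF aP _ na refl u yP(1)] yP(2) by blast
    have "\<not> y + u + v \<doteq> a" if v: "a \<doteq> v" for v
    proof
      assume "y + u + v \<doteq> a"
      then have w: "a \<doteq> y + u + v" by (rule sim_sym)
      have uw: "u \<doteq> y + u + v" using sim_trans[OF sim_sym[OF u] w] .
      have wg: "y + u + v \<in> gen a" using w by (rule gen.base)
      have "y + u + v - (y + u) \<notin> gen a"
        using twist_absorb[of "gen a" "y + u" u "y + u + v", OF genK] fP fg ug wg uw yP by simp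
      then show False using v gen.base by simp
    qed
    then show ?thesis using fP fg by (simp add: free_def)
  qed
  show "y - u \<in> free a" if r: "y - u \<in> insert 0 R"
  proof -
    have f: "y - u \<in> \<Phi>"
      using r
    proof (cases rule: diff_cases)
      case 1 then show ?thesis using ug yP by simp
    next
      case 3
      then have 3: "u - y \<in> \<Phi>" by simp
      have "y + (u - y) \<doteq> a" using sim_sym[OF u] by simp
      then have "y \<doteq> a \<or> u - y \<doteq> a" using indecD[OF a yP(1) 3] by blast
      then have "a \<doteq> u - y" using yP(2) gen.base sim_sym by blast
      then show ?thesis using yfree[of "u - y"] sim_sym[OF u] by simp
    next
      case 4
      then have "u \<doteq> y" using uP yP by (intro edge_sim edgeI) auto
      then show ?thesis using gen_sim[OF ug] yP by blast
    qed
    have fg: "y - u \<notin> gen a"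
      using gen.step[of "y - u" a u y] u yP Phi_R by auto
    have "\<not> y - u + v \<doteq> a" if v: "a \<doteq> v" for v
    proof
      assume w: "y - u + v \<doteq> a"
      have vP: "v \<in> \<Phi>" using v aP sim_Phi by blast
      have wR: "y - u + v \<in> R" using sim_Phi[OF sim_sym[OF w] aP] Phi_R by blast
      have ny: "\<not> a \<doteq> y" using yP(2) gen.base by blast
      have "u + (y - u) \<doteq> u \<or> v + (y - u) \<doteq> y - u"
      proof (rule sum_sim)
        show "u \<doteq> v" using sim_trans[OF sim_sym[OF u] v] .
        show "\<not> u + (y - u) \<doteq> v + (y - u)"
          using sim_trans[of y "y - u + v" a] w ny sim_sym[of y a] by (auto simp: add.commute)
        show "v + (y - u) \<in> R" using wR by (simp add: add.commute)
      qed (use uP f yP Phi_R in auto)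
      then have "y \<doteq> u \<or> y - u + v \<doteq> y - u" by (simp add: add.commute)
      then show False
      proof
        assume "y \<doteq> u" then show False using ny sim_trans[OF u sim_sym] by blast
      next
        assume "y - u + v \<doteq> y - u"
        then have "a \<doteq> y - u" using sim_trans[OF sim_sym[OF w]] by blast
        then show False using fg gen.base by blast
      qed
    qed
    then show ?thesis using f fg by (simp add: free_def)
  qed
qed

text \<open>Zero counts as a target, so an element of \<open>Y\<close> can stabilise
  \<open>Y\<close> only if \<open>Y\<close> contains zero.\<close>

definition stab :: "'a set \<Rightarrow> 'a set" where
  "stab Y = {d \<in> R. \<forall>y\<in>Y. (y + d \<in> insert 0 R \<longrightarrow> y + d \<in> Y) \<and> (y - d \<in> insert 0 R \<longrightarrow> y - d \<in> Y)}"

lemma stab_uminus: "d \<in> stab Y \<Longrightarrow> -d \<in> stab Y"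
  by (auto simp: stab_def)

lemma stab_translate: "\<lbrakk>d \<in> stab Y; y \<in> Y; y + d \<in> insert 0 R\<rbrakk> \<Longrightarrow> y + d \<in> Y"
  by (auto simp: stab_def)

text \<open>By \<open>jacobi\<close>, translating by \<open>d\<close> and \<open>e\<close> in one of
  the two orders passes through a root or zero. If the total is zero, the intermediate value
  \<open>y + d\<close> is \<open>-e\<close>.\<close>

lemma stab_add:
  assumes Y: "Y \<subseteq> R" and d: "d \<in> stab Y" and e: "e \<in> stab Y" and R: "d + e \<in> R"
  shows "d + e \<in> stab Y"
proof -
  have plus: "y + (d + e) \<in> Y"
    if y: "y \<in> Y" and r: "y + (d + e) \<in> insert 0 R" and d: "d \<in> stab Y" and e: "e \<in> stab Y" and R: "d + e \<in> R"
    for y d e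
  proof -
    have P: "y \<in> R" "d \<in> R" "e \<in> R" using y Y d e by (auto simp: stab_def)
    have "y + d \<in> insert 0 R \<or> y + e \<in> insert 0 R"
    proof (cases "y + (d + e) = 0")
      case True
      then have "y + d = -e" by (simp add: eq_neg_iff_add_eq_0 add.assoc)
      then show ?thesis using P by simp
    next
      case False
      then have "d + e + y \<in> R" using r by (simp add: add.commute)
      then show ?thesis using jacobi[of d e y] P R by (simp add: add.commute)
    qed
    then show ?thesis
    proof
      assume "y + d \<in> insert 0 R"
      then have "y + d \<in> Y" using stab_translate[OF d y] by blast
      moreover have "y + d + e \<in> insert 0 R" using r by (simp add: add.assoc)
      ultimately show ?thesis using stab_translate[OF e] by (metis add.assoc)
    next
      assume "y + e \<in> insert 0 R"
      then have "y + e \<in> Y" using stab_translate[OF e y] by blast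
      moreover have "y + e + d \<in> insert 0 R" using r by (simp add: ac_simps)
      ultimately show ?thesis using stab_translate[OF d] by (metis add.assoc add.commute)
    qed
  qed
  have "y - (d + e) \<in> Y" if "y \<in> Y" "y - (d + e) \<in> insert 0 R" for y
  proof -
    have eq: "y + (-d + -e) = y - (d + e)" by simp
    have "-d + -e \<in> R" using R uminus_R[of "d + e"] by simp
    then show ?thesis
      using plus[OF that(1) _ stab_uminus[OF d] stab_uminus[OF e]] that(2) unfolding eq by blast
  qed
  then show ?thesis using plus d e R unfolding stab_def by blast
qed

text \<open>\<open>free_translate\<close> handles the class of \<open>a\<close>;
  \<open>sim_split\<close> and \<open>stab_add\<close> carry this through the generation.\<close>

lemma gen_stab_free:
  assumes a: "indec a"
  shows "gen a \<subseteq> stab (free a)"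
proof
  have aP: "a \<in> \<Phi>" using a by (simp add: indec_def)
  have base: "u \<in> stab (free a)" if "a \<doteq> u" for u
    using that free_translate[OF a _ that] sim_Phi[OF that aP] Phi_R unfolding stab_def by blast
  have Y: "free a \<subseteq> R" using Phi_R by (auto simp: free_def)
  have key: "x' \<in> stab (free a)" if "x \<in> gen a" "x \<doteq> x'" for x x'
    using that
  proof (induction arbitrary: x' rule: gen.induct)
    case (base x)
    then show ?case using \<open>\<And>u. a \<doteq> u \<Longrightarrow> u \<in> stab (free a)\<close> sim_trans by blast
  next
    case (step k u x)
    have P: "k \<in> \<Phi>" "u \<in> \<Phi>" using step.hyps aP gen_Phi sim_Phi by blast+
    have s: "k + u \<doteq> x'" using step.hyps(4) step.prems by (rule sim_trans)
    consider "k \<doteq> x'" | "u \<doteq> x'" | "\<not> k + u \<doteq> k" "\<not> k + u \<doteq> u"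
      using s unfolding sim_iff by metis
    then show ?case
    proof cases
      case 1 then show ?thesis by (rule step.IH)
    next
      case 2 then show ?thesis using base sim_trans[OF step.hyps(2)] by blast
    next
      case 3
      then obtain d v where dv: "x' = d + v" "k \<doteq> d" "u \<doteq> v"
        using sim_split[OF P step.hyps(3) _ _ s] by blast
      have "d + v \<in> R" using sim_Phi[OF s closed_Phi[OF P step.hyps(3)]] dv Phi_R by simp
      then show ?thesis
        using stab_add[OF Y step.IH[OF dv(2)] base[OF sim_trans[OF step.hyps(2) dv(3)]]] dv by simp
    qed
  qed
  show "x \<in> stab (free a)" if "x \<in> gen a" for x using key[OF that sim_refl] .
qed

lemma free_notin_stab: "y \<in> free a \<Longrightarrow> y \<notin> stab (free a)"
  using zero_notin Phi_R[of 0] by (auto simp: stab_def free_def)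

end

section \<open>Bases and supports\<close>

locale based_roots =
  fixes R S :: "'a::euclidean_space set"
  assumes finite_R: "finite R" and finite_S: "finite S" and indep_S: "independent S"
    and S_R: "S \<subseteq> R" and zero_R: "0 \<notin> R" and uminus_R: "x \<in> R \<Longrightarrow> -x \<in> R"
    and add_root: "\<lbrakk>x \<in> R; y \<in> R; x \<bullet> y < 0\<rbrakk> \<Longrightarrow> x + y \<in> insert 0 R"
    and comb: "x \<in> R \<Longrightarrow> \<exists>c::'a \<Rightarrow> int. x = (\<Sum>\<theta>\<in>S. of_int (c \<theta>) *\<^sub>R \<theta>)
      \<and> ((\<forall>\<theta>\<in>S. c \<theta> \<ge> 0) \<or> (\<forall>\<theta>\<in>S. c \<theta> \<le> 0))"
begin

abbreviation "P \<equiv> pos_roots R S"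

lemma coeffs_eqI:
  assumes "\<And>\<theta>. \<theta> \<notin> S \<Longrightarrow> c \<theta> = 0" and "x = (\<Sum>\<theta>\<in>S. of_int (c \<theta>) *\<^sub>R \<theta>)"
  shows "coeffs S x = c"
  unfolding coeffs_def
proof (rule the_equality)
  show "(\<forall>\<theta>. \<theta> \<notin> S \<longrightarrow> c \<theta> = 0) \<and> x = (\<Sum>\<theta>\<in>S. of_int (c \<theta>) *\<^sub>R \<theta>)" using assms by blast
next
  fix d assume d: "(\<forall>\<theta>. \<theta> \<notin> S \<longrightarrow> d \<theta> = 0) \<and> x = (\<Sum>\<theta>\<in>S. of_int (d \<theta>) *\<^sub>R \<theta>)"
  have "(\<Sum>\<theta>\<in>S. (of_int (d \<theta>) - of_int (c \<theta>)) *\<^sub>R \<theta>) = 0"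
    using d assms(2) by (simp add: scaleR_diff_left sum_subtractf)
  then have "of_int (d \<theta>) - of_int (c \<theta>) = (0::real)" if "\<theta> \<in> S" for \<theta>
    using independentD[OF indep_S finite_S order_refl _ that, of "\<lambda>\<theta>. of_int (d \<theta>) - of_int (c \<theta>)"] by blast
  then show "d = c" using d assms(1) by (intro ext) (metis eq_iff_diff_eq_0 of_int_eq_iff)
qed

lemma coeffs_exist:
  assumes "x \<in> R"
  shows "\<theta> \<notin> S \<Longrightarrow> coeffs S x \<theta> = 0" and "x = (\<Sum>\<theta>\<in>S. of_int (coeffs S x \<theta>) *\<^sub>R \<theta>)"
    and "(\<forall>\<theta>\<in>S. coeffs S x \<theta> \<ge> 0) \<or> (\<forall>\<theta>\<in>S. coeffs S x \<theta> \<le> 0)"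
proof -
  obtain c :: "'a \<Rightarrow> int" where c: "x = (\<Sum>\<theta>\<in>S. of_int (c \<theta>) *\<^sub>R \<theta>)"
    "(\<forall>\<theta>\<in>S. c \<theta> \<ge> 0) \<or> (\<forall>\<theta>\<in>S. c \<theta> \<le> 0)" using comb[OF assms] by blast
  define d where "d \<theta> = (if \<theta> \<in> S then c \<theta> else 0)" for \<theta>
  have xd: "x = (\<Sum>\<theta>\<in>S. of_int (d \<theta>) *\<^sub>R \<theta>)"
    by (subst c(1), rule sum.cong) (auto simp: d_def)
  have d: "coeffs S x = d"
    by (rule coeffs_eqI[OF _ xd]) (simp add: d_def)
  show "\<theta> \<notin> S \<Longrightarrow> coeffs S x \<theta> = 0" by (simp add: d d_def)
  show "x = (\<Sum>\<theta>\<in>S. of_int (coeffs S x \<theta>) *\<^sub>R \<theta>)"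
    unfolding d by (rule xd)
  show "(\<forall>\<theta>\<in>S. coeffs S x \<theta> \<ge> 0) \<or> (\<forall>\<theta>\<in>S. coeffs S x \<theta> \<le> 0)"
    using c(2) by (simp add: d d_def)
qed

lemma coeffs_add:
  assumes "x \<in> R" "y \<in> R"
  shows "coeffs S (x + y) = (\<lambda>\<theta>. coeffs S x \<theta> + coeffs S y \<theta>)"
proof (rule coeffs_eqI)
  show "x + y = (\<Sum>\<theta>\<in>S. of_int (coeffs S x \<theta> + coeffs S y \<theta>) *\<^sub>R \<theta>)"
    using coeffs_exist(2)[OF assms(1)] coeffs_exist(2)[OF assms(2)]
    by (simp add: scaleR_add_left sum.distrib)
qed (simp add: coeffs_exist(1) assms)

lemma coeffs_uminus:
  assumes "x \<in> R"
  shows "coeffs S (-x) = (\<lambda>\<theta>. - coeffs S x \<theta>)"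
proof (rule coeffs_eqI)
  show "-x = (\<Sum>\<theta>\<in>S. of_int (- coeffs S x \<theta>) *\<^sub>R \<theta>)"
    by (subst coeffs_exist(2)[OF assms]) (simp add: sum_negf)
qed (simp add: coeffs_exist(1) assms)

lemma coeffs_simple:
  assumes "\<theta> \<in> S"
  shows "coeffs S \<theta> = (\<lambda>t. if t = \<theta> then 1 else 0)"
proof (rule coeffs_eqI)
  have "(\<Sum>t\<in>S. of_int (if t = \<theta> then 1 else 0) *\<^sub>R t) = (\<Sum>t\<in>S. if t = \<theta> then t else 0)"
    by (rule sum.cong) auto
  then show "\<theta> = (\<Sum>t\<in>S. of_int (if t = \<theta> then 1 else 0) *\<^sub>R t)"
    using assms finite_S by simp
qed (use assms in auto)

lemma P_iff: "x \<in> P \<longleftrightarrow> x \<in> R \<and> (\<forall>\<theta>\<in>S. coeffs S x \<theta> \<ge> 0)"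
  by (simp add: pos_roots_def)

lemma P_R: "x \<in> P \<Longrightarrow> x \<in> R"
  by (simp add: P_iff)

lemma S_P: "\<theta> \<in> S \<Longrightarrow> \<theta> \<in> P"
  using S_R by (auto simp: P_iff coeffs_simple)

lemma coeffs_zero: "x \<in> R \<Longrightarrow> \<exists>\<theta>\<in>S. coeffs S x \<theta> \<noteq> 0"
  using coeffs_exist(2)[of x] zero_R by (metis (no_types, lifting) of_int_0 scaleR_zero_left sum.neutral)

lemma P_uminus: "x \<in> R \<Longrightarrow> x \<notin> P \<longleftrightarrow> -x \<in> P"
  using coeffs_exist(3)[of x] coeffs_zero[of x] uminus_R[of x] coeffs_uminus[of x]
  by (auto simp: P_iff) (metis linorder_not_less nle_le)+

lemma P_add: "\<lbrakk>x \<in> P; y \<in> P; x + y \<in> R\<rbrakk> \<Longrightarrow> x + y \<in> P"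
  by (simp add: P_iff coeffs_add)

section \<open>Heights, supports and chains of positive roots\<close>

definition ht :: "'a \<Rightarrow> nat" where
  "ht x = nat (\<Sum>\<theta>\<in>S. coeffs S x \<theta>)"

lemma ht_pos: "x \<in> P \<Longrightarrow> ht x > 0"
proof -
  assume x: "x \<in> P"
  obtain \<theta> where "\<theta> \<in> S" "coeffs S x \<theta> \<noteq> 0" using coeffs_zero x P_R by blast
  then have "(\<Sum>\<theta>\<in>S. coeffs S x \<theta>) > 0"
    using x by (intro sum_pos2[OF finite_S]) (auto simp: P_iff order_less_le)
  then show ?thesis by (simp add: ht_def)
qed

lemma ht_add: "\<lbrakk>x \<in> P; y \<in> P\<rbrakk> \<Longrightarrow> ht (x + y) = ht x + ht y"
  unfolding ht_def
  by (simp add: coeffs_add P_R sum.distrib) (simp add: nat_add_distrib sum_nonneg P_iff)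

lemma ht_simple: "\<theta> \<in> S \<Longrightarrow> ht \<theta> = 1"
  unfolding ht_def using finite_S by (simp add: coeffs_simple)

lemma simple_not_sum: "\<lbrakk>\<theta> \<in> S; x \<in> P; y \<in> P\<rbrakk> \<Longrightarrow> x + y \<noteq> \<theta>"
  using ht_add[of x y] ht_simple[of \<theta>] ht_pos[of x] ht_pos[of y] by auto

lemma supp_add: "\<lbrakk>x \<in> P; y \<in> P\<rbrakk> \<Longrightarrow> supp S (x + y) = supp S x \<union> supp S y"
  unfolding supp_def by (auto simp: coeffs_add P_R P_iff add_nonneg_eq_0_iff)

lemma supp_simple: "\<theta> \<in> S \<Longrightarrow> supp S \<theta> = {\<theta>}"
  by (auto simp: supp_def coeffs_simple)

text \<open>Expanding the squared norm of \<open>p\<close> in the base yields \<theta> with positive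
  coefficient and positive inner product with \<open>p\<close>. The root \<open>p - \<theta>\<close>
  cannot be negative, since \<theta> would then be a sum of two positive roots.\<close>

lemma pos_root_split:
  assumes p: "p \<in> P"
  shows "p \<in> S \<or> (\<exists>q\<in>P. \<exists>\<theta>\<in>S. p = q + \<theta>)"
proof -
  have pR: "p \<in> R" using p P_R by blast
  have "p \<bullet> p > 0" using pR zero_R by auto
  moreover have "p \<bullet> p = (\<Sum>\<theta>\<in>S. of_int (coeffs S p \<theta>) * (p \<bullet> \<theta>))"
    by (subst (2) coeffs_exist(2)[OF pR]) (simp add: inner_sum_right)
  ultimately obtain \<theta> where \<theta>: "\<theta> \<in> S" "of_int (coeffs S p \<theta>) * (p \<bullet> \<theta>) > 0"
    by (metis (no_types, lifting) not_le sum_nonpos)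
  have "coeffs S p \<theta> \<ge> 0" using p \<theta> by (simp add: P_iff)
  then have "p \<bullet> \<theta> > 0" using \<theta>(2) by (auto simp: zero_less_mult_iff)
  then have r: "p + -\<theta> \<in> insert 0 R" using add_root[of p "-\<theta>"] pR \<theta>(1) S_R uminus_R by auto
  show ?thesis
  proof (cases "p = \<theta>")
    case False
    then have R: "p - \<theta> \<in> R" using r by auto
    show ?thesis
    proof (cases "p - \<theta> \<in> P")
      case True
      then show ?thesis using \<theta>(1) by (intro disjI2 bexI[of _ "p - \<theta>"] bexI[of _ \<theta>]) auto
    next
      case False
      then have "\<theta> - p \<in> P" using P_uminus[OF R] by simp
      then show ?thesis using simple_not_sum[OF \<theta>(1) p, of "\<theta> - p"] by simp
    qed
  qed (use \<theta> in simp)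
qed

text \<open>If a root of least height in \<open>X\<close> is not simple, it is
  \<open>q + \<theta>\<close> with \<open>q\<close> outside \<open>X\<close>; co-closedness puts
  \<theta> into \<open>X\<close>.\<close>

lemma coclosed_simple:
  assumes X: "X \<subseteq> P" "closed_set R S (P - X)" "X \<noteq> {}"
  shows "\<exists>\<theta>\<in>S. \<theta> \<in> X"
proof -
  obtain x where x: "x \<in> X" "\<And>y. y \<in> X \<Longrightarrow> ht x \<le> ht y"
    using X(3) ex_has_least_nat[of "\<lambda>x. x \<in> X" _ ht] by blast
  have xP: "x \<in> P" using x X by auto
  show ?thesis
  proof (cases "x \<in> S")
    case False
    then obtain q \<theta> where q: "q \<in> P" "\<theta> \<in> S" "x = q + \<theta>" using pos_root_split[OF xP] by blast
    have \<theta>P: "\<theta> \<in> P" using q(2) by (rule S_P)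
    have "ht q < ht x" using ht_add[OF q(1) \<theta>P] ht_pos[OF \<theta>P] q(3) by simp
    then have "q \<notin> X" using x(2) by force
    then have "\<theta> \<in> X" using X(2) q \<theta>P x P_R[OF xP] unfolding closed_set_def by auto
    then show ?thesis using q by blast
  qed (use x in blast)
qed

text \<open>All partial sums are positive roots. The terms are arbitrary positive roots because
  terms get merged in the induction of \<open>supp_subset_of_coclosed\<close>.\<close>

fun chain :: "'a \<Rightarrow> 'a list \<Rightarrow> bool" where
  "chain x [] \<longleftrightarrow> x \<in> P"
| "chain x (y # ys) \<longleftrightarrow> x \<in> P \<and> y \<in> P \<and> chain (x + y) ys"

lemma chain_P: "chain x ys \<Longrightarrow> x \<in> P"
  by (cases ys) auto

lemma chain_append: "chain x (ys @ [y]) \<longleftrightarrow> chain x ys \<and> y \<in> P \<and> foldl (+) x ys + y \<in> P"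
proof (induction ys arbitrary: x)
  case Nil
  then show ?case by auto
qed auto

lemma chain_simple:
  assumes "p \<in> P"
  shows "\<exists>x ys. chain x ys \<and> foldl (+) x ys = p \<and> supp S p = set (x # ys)"
  using assms
proof (induction "ht p" arbitrary: p rule: less_induct)
  case less
  show ?case
  proof (cases "p \<in> S")
    case True
    then show ?thesis
      using less.prems supp_simple by (intro exI[of _ p] exI[of _ "[]"]) auto
  next
    case False
    then obtain q \<theta> where q: "q \<in> P" "\<theta> \<in> S" "p = q + \<theta>" using pos_root_split[OF less.prems] by blast
    have \<theta>P: "\<theta> \<in> P" using q(2) by (rule S_P)
    have "ht q < ht p" using ht_add[OF q(1) \<theta>P] ht_pos[OF \<theta>P] q(3) by simp
    then obtain x ys where "chain x ys" "foldl (+) x ys = q" "supp S q = set (x # ys)"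
      using less.hyps q(1) by blast
    then show ?thesis
      using less.prems q \<theta>P supp_add[OF q(1) \<theta>P] supp_simple[OF q(2)]
      by (intro exI[of _ x] exI[of _ "ys @ [\<theta>]"]) (auto simp: chain_append)
  qed
qed

end

section \<open>Inversion sets and their splittings\<close>

locale inversion = based_roots +
  fixes \<Phi> assumes inv: "inversion_set R S \<Phi>"
begin

lemma Phi_P: "\<Phi> \<subseteq> P"
  using inv by (simp add: inversion_set_def closed_set_def)

sublocale root_partition R \<Phi> "P - \<Phi>"
proof
  show "finite R" by (rule finite_R)
  show "\<lbrakk>x \<in> R; y \<in> R; x \<bullet> y < 0\<rbrakk> \<Longrightarrow> x + y \<in> insert 0 R" for x y by (rule add_root)
  show "x \<in> R \<longleftrightarrow> x \<in> \<Phi> \<or> x \<in> P - \<Phi> \<or> -x \<in> \<Phi> \<or> -x \<in> P - \<Phi>" for x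
    using P_uminus[of x] uminus_R[of "-x"] P_R[of x] P_R[of "-x"] Phi_P by auto
  show "x \<in> \<Phi> \<Longrightarrow> x \<notin> P - \<Phi>" for x by simp
  show "x \<in> \<Phi> \<union> (P - \<Phi>) \<Longrightarrow> -x \<notin> \<Phi> \<union> (P - \<Phi>)" for x
    using P_uminus[of x] P_R[of x] Phi_P by auto
  show "\<lbrakk>x \<in> \<Phi>; y \<in> \<Phi>; x + y \<in> R\<rbrakk> \<Longrightarrow> x + y \<in> \<Phi>" for x y
    using inv by (simp add: inversion_set_def closed_set_def)
  show "\<lbrakk>x \<in> P - \<Phi>; y \<in> P - \<Phi>; x + y \<in> R\<rbrakk> \<Longrightarrow> x + y \<in> P - \<Phi>" for x y
    using inv by (simp add: inversion_set_def coclosed_set_def closed_set_def)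
qed

notation sim (infix "\<doteq>" 50)

lemma edges_eq: "inv_graph_edges R S \<Phi> = edges"
proof -
  have "x \<in> uminus ` X \<longleftrightarrow> -x \<in> X" for x :: 'a and X by (auto intro: image_eqI[of _ _ "-x"])
  then show ?thesis unfolding inv_graph_edges_def edges_def by simp
qed

lemma cl_Phi: "x \<in> \<Phi> \<Longrightarrow> cl x \<subseteq> \<Phi>"
  using sim_Phi by (auto simp: cl_def)

lemma components_eq: "components R S \<Phi> = cl ` \<Phi>"
proof -
  have "{y \<in> \<Phi>. (x, y) \<in> edges\<^sup>*} = cl x" if "x \<in> \<Phi>" for x
    using cl_Phi[OF that] by (auto simp: cl_def sim_def)
  then show ?thesis unfolding components_def edges_eq by auto
qed

text \<open>Induction on the length of chains with total in \<open>X\<close>. Merging the first two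
  terms puts \<open>x + y\<close> and the later terms into \<open>D\<close>; it remains to find one
  of \<open>x\<close>, \<open>y\<close> in \<open>D\<close>, the other being a difference.\<close>

lemma supp_subset_of_coclosed:
  assumes X: "X \<subseteq> P" "closed_set R S (P - X)" and D: "X \<subseteq> D"
    and neg: "\<And>x. x \<in> D \<Longrightarrow> -x \<in> D" and add: "\<And>x y. \<lbrakk>x \<in> D; y \<in> D; x + y \<in> R\<rbrakk> \<Longrightarrow> x + y \<in> D"
    and x: "x \<in> X"
  shows "supp S x \<subseteq> D"
proof -
  have diff: "u \<in> D" if "u + v \<in> D" "v \<in> D" "u \<in> R" for u v
    using add[OF that(1) neg[OF that(2)]] that(3) by simp
  have key: "set (x # ys) \<subseteq> D" if "chain x ys" "foldl (+) x ys \<in> X" for x ys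
    using that
  proof (induction "length ys" arbitrary: x ys rule: less_induct)
    case less
    show ?case
    proof (cases ys)
      case Nil
      then show ?thesis using less.prems D by auto
    next
      case (Cons y zs)
      have P: "x \<in> P" "y \<in> P" "x + y \<in> P" using less.prems(1) Cons chain_P by auto
      have xy: "set ((x + y) # zs) \<subseteq> D"
        using less.hyps[of zs "x + y"] less.prems Cons by simp
      show ?thesis
      proof (cases zs)
        case Nil
        then have "x + y \<in> X" using less.prems Cons by simp
        \<comment> \<open>Co-closedness is invoked here, for a chain of two terms.\<close>
        then have "x \<in> X \<or> y \<in> X" using X(2) P P_R[OF P(3)] unfolding closed_set_def by auto
        then have "x \<in> D \<and> y \<in> D"
          using D xy diff[of x y] diff[of y x] P P_R by (auto simp: add.commute)
        then show ?thesis using Cons Nil by simp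
      next
        case (Cons z ws)
        have Pz: "z \<in> P" "x + y + z \<in> P" "chain (x + y + z) ws"
          using less.prems(1) Cons \<open>ys = y # zs\<close> chain_P by auto
        \<comment> \<open>The third term can be merged with \<open>x\<close> or with
          \<open>y\<close> instead; the other of these two is then a term of a shorter
          chain.\<close>
        have "x + z \<in> R \<or> y + z \<in> R"
          using jacobi[of x y z] P Pz P_R add_nonzero[of x z] add_nonzero[of y z] by auto
        then have "x \<in> D \<or> y \<in> D"
        proof
          assume "x + z \<in> R"
          then have "chain (x + z) (y # ws)" "foldl (+) (x + z) (y # ws) \<in> X"
            using less.prems P Pz P_add Cons \<open>ys = y # zs\<close> by (auto simp: ac_simps)
          from less.hyps[OF _ this] show ?thesis using Cons \<open>ys = y # zs\<close> by simp
        next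
          assume "y + z \<in> R"
          then have "chain (y + z) (x # ws)" "foldl (+) (y + z) (x # ws) \<in> X"
            using less.prems P Pz P_add Cons \<open>ys = y # zs\<close> by (auto simp: ac_simps)
          from less.hyps[OF _ this] show ?thesis using Cons \<open>ys = y # zs\<close> by simp
        qed
        then have "x \<in> D \<and> y \<in> D"
          using xy diff[of x y] diff[of y x] P P_R by (auto simp: add.commute)
        then show ?thesis using xy \<open>ys = y # zs\<close> by simp
      qed
    qed
  qed
  have "x \<in> P" using x X by auto
  then show ?thesis using chain_simple key x by metis
qed

text \<open>The case of co-closedness that needs the graph is a sum of elements of
  \<open>\<Phi> - K\<close> and \<open>P - \<Phi>\<close>: inside \<open>K\<close> it would be
  adjacent to its summand outside the saturated set \<open>K\<close>.\<close>

lemma inversion_of_split: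
  assumes K: "K \<subseteq> \<Phi>" and sat: "\<And>x y. \<lbrakk>x \<in> K; x \<doteq> y\<rbrakk> \<Longrightarrow> y \<in> K"
    and add: "\<And>x y. \<lbrakk>x \<in> K; y \<in> K; x + y \<in> R\<rbrakk> \<Longrightarrow> x + y \<in> K"
    and prime: "\<And>x y. \<lbrakk>x \<in> \<Phi> - K; y \<in> \<Phi> - K\<rbrakk> \<Longrightarrow> x + y \<notin> K"
  shows "inversion_set R S K"
proof -
  have mixed: "x + y \<notin> K" if "x \<in> \<Phi> - K" "y \<in> P - \<Phi>" for x y
  proof
    assume xy: "x + y \<in> K"
    then have "(x + y, x) \<in> edges" using that K by (intro edgeI) auto
    then show False using sat[OF xy edge_sim] that by blast
  qed
  have "x + y \<notin> K" if xy: "x \<in> P - K" "y \<in> P - K" "x + y \<in> R" for x y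
  proof -
    consider "x \<in> \<Phi> - K" "y \<in> \<Phi> - K" | "x \<in> \<Phi> - K" "y \<in> P - \<Phi>" | "y \<in> \<Phi> - K" "x \<in> P - \<Phi>"
      | "x \<in> P - \<Phi>" "y \<in> P - \<Phi>" using xy by blast
    then show ?thesis
    proof cases
      case 1 then show ?thesis by (rule prime)
    next
      case 2 then show ?thesis by (rule mixed)
    next
      case 3 then show ?thesis using mixed[of y x] by (simp add: add.commute)
    next
      case 4 then show ?thesis using closed_Psi[OF 4 xy(3)] K by blast
    qed
  qed
  then show ?thesis
    unfolding inversion_set_def coclosed_set_def closed_set_def using K Phi_P add P_add by auto
qed

text \<open>Passing from \<open>K\<close> to \<open>\<Phi> - K\<close> interchanges the conditions
  \<open>add\<close> and \<open>prime\<close>, so both parts are inversion sets.\<close>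

lemma irreducible_split:
  assumes irr: "irreducible_inv R S \<Phi>"
    and K: "K \<subseteq> \<Phi>" and sat: "\<And>x y. \<lbrakk>x \<in> K; x \<doteq> y\<rbrakk> \<Longrightarrow> y \<in> K"
    and add: "\<And>x y. \<lbrakk>x \<in> K; y \<in> K; x + y \<in> R\<rbrakk> \<Longrightarrow> x + y \<in> K"
    and prime: "\<And>x y. \<lbrakk>x \<in> \<Phi> - K; y \<in> \<Phi> - K\<rbrakk> \<Longrightarrow> x + y \<notin> K" and ne: "K \<noteq> {}"
  shows "K = \<Phi>"
proof -
  have 1: "inversion_set R S K" using inversion_of_split[OF K sat add prime] .
  have 2: "inversion_set R S (\<Phi> - K)"
  proof (rule inversion_of_split)
    show "y \<in> \<Phi> - K" if "x \<in> \<Phi> - K" "x \<doteq> y" for x y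
      using that sat[of y x] sim_sym sim_Phi by blast
    show "x + y \<in> \<Phi> - K" if "x \<in> \<Phi> - K" "y \<in> \<Phi> - K" "x + y \<in> R" for x y
      using that prime closed_Phi by blast
    show "x + y \<notin> \<Phi> - K" if "x \<in> \<Phi> - (\<Phi> - K)" "y \<in> \<Phi> - (\<Phi> - K)" for x y
      using that add[of x y] Phi_R[of "x + y"] by blast
  qed auto
  have "K = \<Phi> \<or> \<Phi> - K = \<Phi>"
    using irr 1 2 K unfolding irreducible_inv_def by (metis Diff_disjoint Diff_partition)
  then show ?thesis using K ne by blast
qed

text \<open>On an edge between the parts, one endpoint is the other plus an element of
  \<open>P - \<Phi>\<close>. Both summands lie outside the part containing the sum, against its
  co-closedness.\<close>

lemma split_saturated:
  assumes "inversion_set R S \<Phi>1" "inversion_set R S \<Phi>2" "\<Phi> = \<Phi>1 \<union> \<Phi>2" "\<Phi>1 \<inter> \<Phi>2 = {}"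
    and "x \<in> \<Phi>1" "x \<doteq> y"
  shows "y \<in> \<Phi>1"
  using assms(6) unfolding sim_def
proof (induction rule: rtrancl_induct)
  case (step y z)
  have no: "u \<notin> X" if "v \<in> \<Phi>" "v \<notin> X" "u - v \<in> P - \<Phi>" "inversion_set R S X" "X \<subseteq> \<Phi>" for u v X
  proof
    assume u: "u \<in> X"
    have "v + (u - v) \<in> R" using u that Phi_R by auto
    then have "v + (u - v) \<in> P - X"
      using that Phi_P unfolding inversion_set_def coclosed_set_def closed_set_def by blast
    then show False using u by simp
  qed
  have "z \<in> \<Phi>" and "y - z \<in> P - \<Phi> \<or> z - y \<in> P - \<Phi>" using step(2) by (auto simp: edges_def)
  then show ?case
    using no[of z \<Phi>1 y] no[of y \<Phi>2 z] step(3) assms(1-4) by blast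
qed (rule assms(5))

section \<open>Addition and simplicity of components in terms of representatives\<close>

lemma mem_cl: "y \<in> cl x \<longleftrightarrow> x \<doteq> y"
  by (simp add: cl_def)

lemma component_memD:
  assumes "A \<in> components R S \<Phi>" "x \<in> A"
  shows "A = cl x" and "x \<in> \<Phi>"
proof -
  obtain a where a: "a \<in> \<Phi>" "A = cl a" using assms(1) unfolding components_eq by blast
  have "a \<doteq> x" using assms(2) unfolding a(2) mem_cl .
  then show "A = cl x" using a(2) unfolding sim_iff by simp
  show "x \<in> \<Phi>" using \<open>a \<doteq> x\<close> a(1) by (rule sim_Phi)
qed

lemma supp_set_mono: "X \<subseteq> Y \<Longrightarrow> supp_set S X \<subseteq> supp_set S Y"
  by (auto simp: supp_set_def)

text \<open>Using \<open>sum_sim\<close> also with the summands exchanged, an element of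
  \<open>Z\<close> outside the class of \<open>a + b\<close> forces \<open>a \<doteq> b\<close> and
  lies in their class. These are exactly the two branches of the definition.\<close>

lemma comp_add_eq:
  assumes a: "a \<in> \<Phi>" and b: "b \<in> \<Phi>" and R: "a + b \<in> R"
    and na: "\<not> a + b \<doteq> a" and nb: "\<not> a + b \<doteq> b"
  shows "comp_add R S \<Phi> (cl a) (cl b) = Some (cl (a + b))"
proof -
  define Z where "Z = comp_Z R (cl a) (cl b)"
  define Cs where "Cs = components R S \<Phi>"
  have ab: "a + b \<in> \<Phi>" using a b R closed_Phi by blast
  have abZ: "a + b \<in> Z"
    using R sim_refl unfolding Z_def comp_Z_def mem_cl by blast
  have ZP: "z \<in> \<Phi>" if "z \<in> Z" for z
    using that a b sim_Phi closed_Phi by (auto simp: Z_def comp_Z_def mem_cl)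
  have other: "a \<doteq> b \<and> z \<doteq> a" if "z \<in> Z" "\<not> z \<doteq> a + b" for z
  proof -
    obtain u v where uv: "z = u + v" "a \<doteq> u" "b \<doteq> v" "u + v \<in> R"
      using \<open>z \<in> Z\<close> by (auto simp: Z_def comp_Z_def mem_cl)
    have ne: "\<not> a + b \<doteq> u + v" using that uv sim_sym by blast
    have "u + v \<doteq> v" using sum_sim[OF a b R uv(4,2,3) ne] na by blast
    moreover have "b + a \<doteq> b \<or> v + u \<doteq> u"
      using sum_sim[of b a v u] a b R uv ne by (simp add: add.commute)
    then have "u + v \<doteq> u" using nb by (simp add: add.commute)
    ultimately show ?thesis using uv unfolding sim_iff by simp
  qed
  have Cs: "C \<in> Cs \<longleftrightarrow> (\<exists>c\<in>\<Phi>. C = cl c)" for C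
    by (auto simp: Cs_def components_eq)
  have Cs_eq: "C = cl z" if "C \<in> Cs" "z \<in> C" for C z
    using component_memD(1) that unfolding Cs_def by blast
  show ?thesis
  proof (cases "\<forall>z\<in>Z. z \<doteq> a + b")
    case True
    then have sub: "Z \<subseteq> cl (a + b)" using sim_sym by (auto simp: mem_cl)
    have "cl (a + b) \<in> Cs" using ab Cs by blast
    have ex: "Z \<noteq> {} \<and> (\<exists>C\<in>Cs. Z \<subseteq> C)" using \<open>cl (a + b) \<in> Cs\<close> sub abZ by blast
    have "(THE C. C \<in> Cs \<and> Z \<subseteq> C) = cl (a + b)"
    proof (rule the_equality)
      show "cl (a + b) \<in> Cs \<and> Z \<subseteq> cl (a + b)" using \<open>cl (a + b) \<in> Cs\<close> sub by blast
      show "C = cl (a + b)" if "C \<in> Cs \<and> Z \<subseteq> C" for C using that abZ Cs_eq by blast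
    qed
    then show ?thesis using ex unfolding comp_add_def Let_def Z_def Cs_def by simp
  next
    case False
    then obtain z where z: "z \<in> Z" "\<not> z \<doteq> a + b" by blast
    have sab: "a \<doteq> b" and za: "z \<doteq> a" using other[OF z] by auto
    have nex: "\<not> (\<exists>C\<in>Cs. Z \<subseteq> C)"
    proof
      assume "\<exists>C\<in>Cs. Z \<subseteq> C"
      then obtain C where "C \<in> Cs" "z \<in> C" "a + b \<in> C" using z abZ by blast
      then have "cl z = cl (a + b)" using Cs_eq by metis
      then show False using z by (simp add: sim_iff)
    qed
    have meet: "{D \<in> Cs. D \<inter> Z \<noteq> {}} = {cl a, cl (a + b)}"
    proof (intro equalityI subsetI)
      fix D assume "D \<in> {D \<in> Cs. D \<inter> Z \<noteq> {}}"
      then obtain w where w: "D \<in> Cs" "w \<in> D" "w \<in> Z" by blast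
      have "D = cl w" using Cs_eq w by blast
      moreover have "w \<doteq> a + b \<or> w \<doteq> a" using other[OF w(3)] by blast
      ultimately show "D \<in> {cl a, cl (a + b)}" unfolding sim_iff by auto
    next
      fix D assume "D \<in> {cl a, cl (a + b)}"
      moreover have "z \<in> cl a" using sim_sym[OF za] by (simp add: mem_cl)
      moreover have "a + b \<in> cl (a + b)" by (simp add: mem_cl)
      moreover have "cl a \<in> Cs" "cl (a + b) \<in> Cs" using a ab Cs by blast+
      ultimately show "D \<in> {D \<in> Cs. D \<inter> Z \<noteq> {}}" using z abZ by blast
    qed
    have ne: "cl (a + b) \<noteq> cl a" using na by (simp add: sim_iff)
    have Cs2: "cl a \<in> Cs" "cl (a + b) \<in> Cs" using a ab Cs by blast+
    have eq: "cl a = cl b" using sab by (simp add: sim_iff)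
    have "(THE C. C \<in> Cs \<and> C \<noteq> cl a \<and> {D \<in> Cs. D \<inter> Z \<noteq> {}} = {cl a, C}) = cl (a + b)"
      unfolding meet using ne Cs2 by (intro the_equality) (auto simp: doubleton_eq_iff)
    moreover have "\<exists>C\<in>Cs. C \<noteq> cl a \<and> {D \<in> Cs. D \<inter> Z \<noteq> {}} = {cl a, C}"
      unfolding meet using ne Cs2 by blast
    ultimately show ?thesis
      using nex eq Cs2(1) unfolding comp_add_def Let_def Z_def Cs_def by simp
  qed
qed

lemma comp_add_SomeD:
  assumes Some: "comp_add R S \<Phi> A B = Some C"
  shows "C \<in> components R S \<Phi> \<and> (\<exists>a\<in>A. \<exists>b\<in>B. a + b \<in> R \<and> a + b \<in> C)"
proof -
  define Z where "Z = comp_Z R A B"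
  define Cs where "Cs = components R S \<Phi>"
  have Cs_eq: "D = E" if "D \<in> Cs" "E \<in> Cs" "z \<in> D" "z \<in> E" for D E z
    using component_memD(1)[of D z] component_memD(1)[of E z] that unfolding Cs_def by simp
  have "C \<in> Cs \<and> C \<inter> Z \<noteq> {}"
  proof (cases "Z \<noteq> {} \<and> (\<exists>D\<in>Cs. Z \<subseteq> D)")
    case True
    then obtain D where D: "D \<in> Cs" "Z \<subseteq> D" "Z \<noteq> {}" by blast
    have "(THE C. C \<in> Cs \<and> Z \<subseteq> C) = D"
      using D Cs_eq by (intro the_equality) blast+
    then have "C = D" using Some True unfolding comp_add_def Let_def Z_def Cs_def by simp
    then show ?thesis using D by auto
  next
    case False
    define T where "T D \<longleftrightarrow> D \<in> Cs \<and> D \<noteq> A \<and> {E \<in> Cs. E \<inter> Z \<noteq> {}} = {A, D}" for D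
    have eq: "comp_add R S \<Phi> A B = (if A = B \<and> A \<in> Cs \<and> (\<exists>D. T D) then Some (THE D. T D) else None)"
      unfolding comp_add_def Let_def Z_def[symmetric] Cs_def[symmetric] T_def Bex_def
      by (rule if_not_P[OF False[unfolded Bex_def]])
    then obtain D where D: "T D" and C: "C = (THE D. T D)" using Some by (auto split: if_splits)
    have "(THE D. T D) = D"
      using D by (intro the_equality) (auto simp: T_def doubleton_eq_iff)
    then have "T C" using C D by simp
    then show ?thesis unfolding T_def by blast
  qed
  then show ?thesis by (auto simp: Z_def Cs_def comp_Z_def)
qed

text \<open>Sums to which \<open>comp_add_eq\<close> does not apply stay in the class of a summand,
  and these never violate \<open>indec\<close>.\<close>

lemma simple_comp_iff: "simple_comp R S \<Phi> C \<longleftrightarrow> (\<exists>a. indec a \<and> C = cl a)"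
proof
  assume C: "simple_comp R S \<Phi> C"
  then obtain a where a: "a \<in> \<Phi>" "C = cl a" by (auto simp: simple_comp_def components_eq)
  have "indec a"
    unfolding indec_def
  proof (intro conjI ballI impI)
    fix x y assume x: "x \<in> \<Phi>" and y: "y \<in> \<Phi>" and xy: "x + y \<doteq> a"
    show "x \<doteq> a \<or> y \<doteq> a"
    proof (rule ccontr)
      assume n: "\<not> ?thesis"
      have "x + y \<in> R" using sim_Phi[OF sim_sym[OF xy] a(1)] by (rule Phi_R)
      moreover have "\<not> x + y \<doteq> x" "\<not> x + y \<doteq> y" using xy n unfolding sim_iff by auto
      ultimately have "comp_add R S \<Phi> (cl x) (cl y) = Some (cl (x + y))"
        using comp_add_eq[OF x y] by blast
      then have "comp_add R S \<Phi> (cl x) (cl y) = Some C" using xy a(2) by (simp add: sim_iff)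
      then have "cl x = C \<or> cl y = C"
        using C x y unfolding simple_comp_def components_eq by blast
      then show False using n a(2) by (simp add: sim_iff)
    qed
  qed (rule a(1))
  then show "\<exists>a. indec a \<and> C = cl a" using a(2) by blast
next
  assume "\<exists>a. indec a \<and> C = cl a"
  then obtain a where a: "indec a" "C = cl a" by blast
  have aP: "a \<in> \<Phi>" using a(1) by (simp add: indec_def)
  show "simple_comp R S \<Phi> C"
    unfolding simple_comp_def
  proof (intro conjI ballI impI)
    fix A B assume A: "A \<in> components R S \<Phi>" and B: "B \<in> components R S \<Phi>"
      and Some: "comp_add R S \<Phi> A B = Some C"
    obtain x y where xy: "x \<in> A" "y \<in> B" "x + y \<in> C" using comp_add_SomeD[OF Some] by blast
    have cl: "A = cl x" "B = cl y" "x \<in> \<Phi>" "y \<in> \<Phi>"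
      using component_memD[OF A xy(1)] component_memD[OF B xy(2)] by auto
    have "x + y \<doteq> a" using xy(3) a(2) sim_sym by (simp add: mem_cl)
    then have "x \<doteq> a \<or> y \<doteq> a" using indecD[OF a(1)] cl by blast
    then show "A = C \<or> B = C" using cl a(2) by (simp add: sim_iff)
  qed (use a aP in \<open>auto simp: components_eq\<close>)
qed

lemma indec_simple: "\<lbrakk>\<theta> \<in> S; \<theta> \<in> \<Phi>\<rbrakk> \<Longrightarrow> indec \<theta>"
  using simple_not_sum Phi_P by (intro indecI) blast+

lemma gen_split:
  assumes "indec a"
  shows "gen a \<subseteq> \<Phi>" and "\<And>x y. \<lbrakk>x \<in> gen a; x \<doteq> y\<rbrakk> \<Longrightarrow> y \<in> gen a"
    and "\<And>x y. \<lbrakk>x \<in> gen a; y \<in> gen a; x + y \<in> R\<rbrakk> \<Longrightarrow> x + y \<in> gen a"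
    and "\<And>x y. \<lbrakk>x \<in> \<Phi> - gen a; y \<in> \<Phi> - gen a\<rbrakk> \<Longrightarrow> x + y \<notin> gen a"
proof -
  have a: "a \<in> \<Phi>" using assms by (simp add: indec_def)
  show "gen a \<subseteq> \<Phi>" using gen_Phi a by blast
  show "\<lbrakk>x \<in> gen a; x \<doteq> y\<rbrakk> \<Longrightarrow> y \<in> gen a" for x y by (rule gen_sim)
  show "\<lbrakk>x \<in> gen a; y \<in> gen a; x + y \<in> R\<rbrakk> \<Longrightarrow> x + y \<in> gen a" for x y by (rule gen_add[OF a])
  show "\<lbrakk>x \<in> \<Phi> - gen a; y \<in> \<Phi> - gen a\<rbrakk> \<Longrightarrow> x + y \<notin> gen a" for x y by (rule gen_prime[OF assms])
qed

section \<open>The implications between the four conditions\<close>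

lemma simple_root_exists:
  assumes "inversion_set R S X" "X \<noteq> {}"
  shows "\<exists>\<theta>\<in>S. \<theta> \<in> X"
  using assms coclosed_simple[of X] by (auto simp: inversion_set_def coclosed_set_def)

lemma supp_component_of_irreducible:
  assumes irr: "irreducible_inv R S \<Phi>" and C: "C \<in> components R S \<Phi>"
  shows "supp_set S C = supp_set S \<Phi>"
proof -
  obtain c where c: "c \<in> \<Phi>" "C = cl c" using C by (auto simp: components_eq)
  define T where "T = supp_set S C"
  \<comment> \<open>The union of the components with support inside \<open>T\<close>. It contains
    \<open>C\<close>, so once it splits off it is all of \<Phi>.\<close>
  define K where "K = {x \<in> \<Phi>. \<forall>y. x \<doteq> y \<longrightarrow> supp S y \<subseteq> T}"
  have sat: "y \<in> K" if "x \<in> K" "x \<doteq> y" for x y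
    using that sim_Phi sim_trans by (auto simp: K_def)
  have KT: "supp S x \<subseteq> T" if "x \<in> K" for x using that sim_refl by (auto simp: K_def)
  have "K = \<Phi>"
  proof (rule irreducible_split[OF irr])
    show "K \<subseteq> \<Phi>" by (auto simp: K_def)
    show "y \<in> K" if "x \<in> K" "x \<doteq> y" for x y using sat that .
    have "c \<in> K" using c by (auto simp: K_def T_def supp_set_def mem_cl)
    then show "K \<noteq> {}" by blast
  next
    fix x y assume x: "x \<in> K" and y: "y \<in> K" and R: "x + y \<in> R"
    have P: "x \<in> \<Phi>" "y \<in> \<Phi>" using x y by (auto simp: K_def)
    \<comment> \<open>By \<open>edge_sum\<close> the property survives each edge. Both alternatives
      keep the support of \<open>z\<close> inside \<open>T\<close>.\<close>
    have "z \<in> K \<or> (\<exists>u\<in>K. \<exists>v\<in>K. z = u + v)" if "x + y \<doteq> z" for z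
      using that unfolding sim_def
    proof (induction rule: rtrancl_induct)
      case base
      then show ?case using x y by blast
    next
      case (step z z')
      from step.IH show ?case
      proof
        assume "z \<in> K" then show ?thesis using sat edge_sim[OF step(2)] by blast
      next
        assume "\<exists>u\<in>K. \<exists>v\<in>K. z = u + v"
        then obtain u v where uv: "u \<in> K" "v \<in> K" "z = u + v" by blast
        have uvP: "u \<in> \<Phi>" "v \<in> \<Phi>" "u + v \<in> R"
          using uv edges_Phi[OF step(2)] Phi_R by (auto simp: K_def)
        consider "(u, z' - v) \<in> edges" | "(v, z' - u) \<in> edges" | "(u, z') \<in> edges" | "(v, z') \<in> edges"
          using edge_sum[OF uvP, of z'] step(2) uv(3) by blast
        then show ?thesis
        proof cases
          case 1
          then have "z' - v \<in> K" using sat[OF uv(1) edge_sim] by blast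
          then show ?thesis using uv(2) by (intro disjI2 bexI[of _ "z' - v"] bexI[of _ v]) auto
        next
          case 2
          then have "z' - u \<in> K" using sat[OF uv(2) edge_sim] by blast
          then show ?thesis using uv(1) by (intro disjI2 bexI[of _ u] bexI[of _ "z' - u"]) auto
        next
          case 3 then show ?thesis using sat[OF uv(1) edge_sim] by blast
        next
          case 4 then show ?thesis using sat[OF uv(2) edge_sim] by blast
        qed
      qed
    qed
    moreover have "supp S (u + v) \<subseteq> T" if "u \<in> K" "v \<in> K" for u v
    proof -
      have "u \<in> P" "v \<in> P" using that Phi_P by (auto simp: K_def)
      then show ?thesis using KT that supp_add by blast
    qed
    ultimately show "x + y \<in> K"
      using KT closed_Phi[OF P R] unfolding K_def by blast
  next
    fix x y assume x: "x \<in> \<Phi> - K" and y: "y \<in> \<Phi> - K"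
    show "x + y \<notin> K"
    proof
      assume xy: "x + y \<in> K"
      \<comment> \<open>By \<open>edge_summand\<close>, \<open>z\<close> keeps a partner with sum in
        \<open>K\<close> or enters \<open>K\<close>. Supports of positive roots do not cancel, so
        that of \<open>z\<close> stays inside \<open>T\<close>.\<close>
      have inv: "z \<in> K \<or> (\<exists>v\<in>\<Phi>. z + v \<in> K)" if "x \<doteq> z" for z
        using that unfolding sim_def
      proof (induction rule: rtrancl_induct)
        case base
        then show ?case using y xy by blast
      next
        case (step z z')
        from step.IH show ?case
        proof
          assume "z \<in> K" then show ?thesis using sat edge_sim[OF step(2)] by blast
        next
          assume "\<exists>v\<in>\<Phi>. z + v \<in> K"
          then obtain v where v: "v \<in> \<Phi>" "z + v \<in> K" by blast
          have zP: "z \<in> \<Phi>" "z + v \<in> R"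
            using edges_Phi[OF step(2)] v Phi_R by (auto simp: K_def)
          consider "(z + v, z' + v) \<in> edges" | "z + v - z' \<in> \<Phi>" | "(z + v, z') \<in> edges"
            using edge_summand[OF zP(1) v(1) zP(2) step(2)] by blast
          then show ?thesis
          proof cases
            case 1 then show ?thesis using sat[OF v(2) edge_sim] v(1) by blast
          next
            case 2
            have "z' + (z + v - z') \<in> K" using v(2) by simp
            then show ?thesis using 2 by blast
          next
            case 3 then show ?thesis using sat[OF v(2) edge_sim] by blast
          qed
        qed
      qed
      have "supp S z \<subseteq> T" if s: "x \<doteq> z" for z
      proof -
        have zP: "z \<in> P" using sim_Phi[OF s] x Phi_P by blast
        from inv[OF s] show ?thesis
        proof
          assume "\<exists>v\<in>\<Phi>. z + v \<in> K"
          then obtain v where v: "v \<in> \<Phi>" "z + v \<in> K" by blast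
          have "supp S z \<subseteq> supp S (z + v)" using supp_add[OF zP, of v] v(1) Phi_P by blast
          then show ?thesis using KT[OF v(2)] by blast
        qed (rule KT)
      qed
      then show False using x by (auto simp: K_def)
    qed
  qed
  then have "supp_set S \<Phi> \<subseteq> T" using KT by (auto simp: supp_set_def)
  moreover have "T \<subseteq> supp_set S \<Phi>"
    unfolding T_def c(2) by (rule supp_set_mono[OF cl_Phi[OF c(1)]])
  ultimately show ?thesis by (simp add: T_def)
qed

text \<open>Without such \<open>u\<close>, the root \<open>t\<close> is in \<open>free s\<close>; it
  is not generated because a simple root is no sum of positive roots. But the support of
  \<open>cl s\<close> lies in the stabiliser of \<open>free s\<close>, which excludes
  \<open>t\<close>.\<close>

lemma absorb_of_mem_supp:
  assumes s: "s \<in> S" "s \<in> \<Phi>" and t: "t \<in> S" "t \<in> \<Phi>" and ne: "\<not> s \<doteq> t"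
    and supp: "t \<in> supp_set S (cl s)"
  shows "\<exists>u. s \<doteq> u \<and> t + u \<doteq> s"
proof (rule ccontr)
  assume no: "\<not> ?thesis"
  have ind: "indec s" using s by (rule indec_simple)
  have "t \<notin> gen s"
  proof
    assume "t \<in> gen s"
    then consider "s \<doteq> t" | k y where "k \<in> gen s" "s \<doteq> y" "t = k + y"
      using gen_cases[OF s(2)] by blast
    then show False
    proof cases
      case 1 then show False using ne by simp
    next
      case (2 k y)
      then have "k \<in> P" "y \<in> P" using gen_Phi s(2) sim_Phi Phi_P by blast+
      then show False using simple_not_sum[OF t(1)] 2(3) by blast
    qed
  qed
  then have free: "t \<in> free s" using t no by (auto simp: free_def)
  obtain x where x: "s \<doteq> x" "t \<in> supp S x" using supp by (auto simp: supp_set_def mem_cl)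
  have "inversion_set R S (gen s)"
    by (rule inversion_of_split) (use gen_split[OF ind] in blast)+
  then have "supp S x \<subseteq> stab (free s)"
  proof (intro supp_subset_of_coclosed[of "gen s" "stab (free s)"])
    show "x \<in> gen s" using x(1) by (rule gen.base)
    show "gen s \<subseteq> stab (free s)" using ind by (rule gen_stab_free)
    show "\<lbrakk>d \<in> stab (free s); e \<in> stab (free s); d + e \<in> R\<rbrakk> \<Longrightarrow> d + e \<in> stab (free s)" for d e
      using stab_add[of "free s" d e] Phi_R by (auto simp: free_def)
  qed (auto simp: inversion_set_def coclosed_set_def stab_uminus)
  then show False using x(2) free_notin_stab[OF free] by blast
qed

lemma irreducible_of_supp_component:
  assumes full: "\<forall>C\<in>components R S \<Phi>. supp_set S C = supp_set S \<Phi>" and ne: "\<Phi> \<noteq> {}"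
  shows "irreducible_inv R S \<Phi>"
  unfolding irreducible_inv_def
proof (intro conjI allI impI inv ne)
  fix \<Phi>1 \<Phi>2
  assume *: "inversion_set R S \<Phi>1 \<and> inversion_set R S \<Phi>2 \<and> \<Phi>1 \<inter> \<Phi>2 = {} \<and> \<Phi> = \<Phi>1 \<union> \<Phi>2"
  show "\<Phi>1 = \<Phi> \<or> \<Phi>2 = \<Phi>"
  proof (rule ccontr)
    assume n: "\<not> ?thesis"
    then have "\<Phi>1 \<noteq> {}" "\<Phi>2 \<noteq> {}" using * by auto
    then obtain s t where s: "s \<in> S" "s \<in> \<Phi>1" and t: "t \<in> S" "t \<in> \<Phi>2"
      using simple_root_exists * by metis
    have P: "s \<in> \<Phi>" "t \<in> \<Phi>" using s t * by auto
    have nst: "\<not> s \<doteq> t" using split_saturated[of \<Phi>1 \<Phi>2 s t] s t * by blast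
    have supp: "x \<in> supp_set S (cl y)" if "x \<in> S" "x \<in> \<Phi>" "y \<in> \<Phi>" for x y
    proof -
      have "x \<in> supp_set S \<Phi>" using that supp_simple[of x] by (auto simp: supp_set_def)
      then show ?thesis using full that components_eq by blast
    qed
    obtain u where u: "s \<doteq> u" "t + u \<doteq> s"
      using absorb_of_mem_supp[OF s(1) P(1) t(1) P(2) nst] supp s t P by blast
    obtain v where v: "t \<doteq> v" "s + v \<doteq> t"
      using absorb_of_mem_supp[OF t(1) P(2) s(1) P(1)] nst sim_sym supp s t P by blast
    have R: "t + u \<in> R" "v + s \<in> R"
      using sim_Phi[OF sim_sym[OF u(2)] P(1)] sim_Phi[OF sim_sym[OF v(2)] P(2)] Phi_R
      by (auto simp: add.commute)
    have v': "v + s \<doteq> t" using v(2) by (simp add: add.commute)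
    \<comment> \<open>Each component absorbs the other, so the two sums lie in the classes of
      \<open>s\<close> and \<open>t\<close> respectively. Either alternative would identify these
      classes.\<close>
    have "t + u \<doteq> t \<or> v + s \<doteq> s"
    proof (rule sum_sim)
      show "u \<in> \<Phi>" using u(1) P(1) sim_Phi by blast
      show "\<not> t + u \<doteq> v + s" using u(2) v' nst unfolding sim_iff by simp
    qed (use P R u v sim_sym in auto)
    then show False using u(2) v' nst unfolding sim_iff by simp
  qed
qed

text \<open>Irreducibility makes \<open>gen a\<close> all of \<Phi>. A generation step is one more
  addition of \<open>cl a\<close>, unless it stays in a class already reached.\<close>

lemma multiples_of_irreducible:
  assumes irr: "irreducible_inv R S \<Phi>" and a: "indec a" and C: "C \<in> components R S \<Phi>"
  shows "\<exists>k\<ge>1. comp_mult R S \<Phi> k (cl a) = Some C"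
proof -
  have aP: "a \<in> \<Phi>" using a by (simp add: indec_def)
  have "gen a = \<Phi>"
  proof (rule irreducible_split[OF irr])
    show "gen a \<noteq> {}" using gen.base[OF sim_refl] by blast
  qed (use gen_split[OF a] in blast)+
  moreover obtain c where c: "c \<in> \<Phi>" "C = cl c" using C by (auto simp: components_eq)
  ultimately have "c \<in> gen a" by simp
  then have "\<exists>k\<ge>1. comp_mult R S \<Phi> k (cl a) = Some (cl c)"
  proof (induction rule: gen.induct)
    case (base x)
    then show ?case by (intro exI[of _ "Suc 0"]) (simp add: sim_iff)
  next
    case (step k y x)
    have P: "k \<in> \<Phi>" "y \<in> \<Phi>" using step.hyps aP gen_Phi sim_Phi by blast+
    have eq: "cl (k + y) = cl x" "cl a = cl y" using step.hyps by (simp_all add: sim_iff)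
    consider "k + y \<doteq> k" | "k + y \<doteq> y" | "\<not> k + y \<doteq> k" "\<not> k + y \<doteq> y" by blast
    then show ?case
    proof cases
      case 1
      then have "cl k = cl x" using eq by (simp add: sim_iff)
      then show ?thesis using step.IH by simp
    next
      case 2
      then have "cl a = cl x" using eq by (simp add: sim_iff)
      then show ?thesis by (intro exI[of _ "Suc 0"]) simp
    next
      case 3
      then have add: "comp_add R S \<Phi> (cl k) (cl a) = Some (cl x)"
        using comp_add_eq[OF P step.hyps(3)] eq by simp
      obtain n where n: "n \<ge> 1" "comp_mult R S \<Phi> n (cl a) = Some (cl k)" using step.IH by blast
      \<comment> \<open>Multiples start at 1 and are \<open>None\<close> at 0; the recursive
        equation needs the form \<open>Suc (Suc m)\<close>.\<close>
      then obtain m where "n = Suc m" by (cases n) auto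
      then show ?thesis using n add by (intro exI[of _ "Suc (Suc m)"]) simp
    qed
  qed
  then show ?thesis using c(2) by simp
qed

text \<open>Simplicity of the last sum of \<open>X\<close> and \<open>A\<close> leaves
  \<open>C = A\<close> or \<open>C = X\<close>, and \<open>X\<close> is a smaller multiple.\<close>

lemma simple_multiple:
  assumes A: "A \<in> components R S \<Phi>" and "comp_mult R S \<Phi> k A = Some C" and "simple_comp R S \<Phi> C"
  shows "C = A"
proof -
  have comp: "X \<in> components R S \<Phi>" if "comp_mult R S \<Phi> n A = Some X" for n X
    using that A comp_add_SomeD
    by (induction R S \<Phi> n A rule: comp_mult.induct) (auto split: option.splits)
  show ?thesis
    using assms(2)
  proof (induction k rule: nat_less_induct)
    case (1 k)
    consider "k = 0" | "k = Suc 0" | m where "k = Suc (Suc m)"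
      by (metis nat.exhaust)
    then show ?case
    proof cases
      case 3
      then obtain X where X: "comp_mult R S \<Phi> (Suc m) A = Some X" "comp_add R S \<Phi> X A = Some C"
        using 1(2) by (auto split: option.splits)
      have "X = C \<or> A = C"
        using assms(3) comp[OF X(1)] A X(2) unfolding simple_comp_def by blast
      then show ?thesis using 1(1) X(1) 3 by auto
    qed (use 1(2) in auto)
  qed
qed

theorem irreducible_iff:
  assumes ne: "\<Phi> \<noteq> {}"
  shows "irreducible_inv R S \<Phi> \<longleftrightarrow> (\<forall>C\<in>components R S \<Phi>. supp_set S C = supp_set S \<Phi>)"
    and "irreducible_inv R S \<Phi> \<longleftrightarrow> (\<exists>!C. simple_comp R S \<Phi> C)"
    and "irreducible_inv R S \<Phi> \<longleftrightarrow> (\<exists>A\<in>components R S \<Phi>. \<forall>C\<in>components R S \<Phi>. C \<noteq> A \<longrightarrow>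
      (\<exists>k\<ge>1. comp_mult R S \<Phi> k A = Some C))" (is "_ \<longleftrightarrow> ?multiples")
proof -
  obtain \<theta> where \<theta>: "\<theta> \<in> S" "\<theta> \<in> \<Phi>" using simple_root_exists[OF inv ne] by blast
  have simple: "simple_comp R S \<Phi> (cl x)" if "x \<in> S" "x \<in> \<Phi>" for x
    using indec_simple[OF that] by (auto simp: simple_comp_iff)
  show "irreducible_inv R S \<Phi> \<longleftrightarrow> (\<forall>C\<in>components R S \<Phi>. supp_set S C = supp_set S \<Phi>)"
    using supp_component_of_irreducible irreducible_of_supp_component ne by blast
  have 1: ?multiples if "irreducible_inv R S \<Phi>"
    using multiples_of_irreducible[OF that indec_simple[OF \<theta>]] \<theta>(2) components_eq by blast
  have 2: "\<exists>!C. simple_comp R S \<Phi> C" if m: ?multiples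
  proof -
    obtain A where A: "A \<in> components R S \<Phi>"
      "\<forall>C\<in>components R S \<Phi>. C \<noteq> A \<longrightarrow> (\<exists>k\<ge>1. comp_mult R S \<Phi> k A = Some C)"
      using m by blast
    have "C = A" if C: "simple_comp R S \<Phi> C" for C
    proof (rule ccontr)
      assume "C \<noteq> A"
      then obtain k where "comp_mult R S \<Phi> k A = Some C"
        using A(2) C unfolding simple_comp_def by blast
      then show False using simple_multiple[OF A(1) _ C] \<open>C \<noteq> A\<close> by blast
    qed
    then show ?thesis using simple[OF \<theta>] by blast
  qed
  have 3: "irreducible_inv R S \<Phi>" if u: "\<exists>!C. simple_comp R S \<Phi> C"
    unfolding irreducible_inv_def
  proof (intro conjI allI impI inv ne)
    fix \<Phi>1 \<Phi>2
    assume *: "inversion_set R S \<Phi>1 \<and> inversion_set R S \<Phi>2 \<and> \<Phi>1 \<inter> \<Phi>2 = {} \<and> \<Phi> = \<Phi>1 \<union> \<Phi>2"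
    show "\<Phi>1 = \<Phi> \<or> \<Phi>2 = \<Phi>"
    proof (rule ccontr)
      assume n: "\<not> ?thesis"
      then have "\<Phi>1 \<noteq> {}" "\<Phi>2 \<noteq> {}" using * by auto
      then obtain s t where s: "s \<in> S" "s \<in> \<Phi>1" and t: "t \<in> S" "t \<in> \<Phi>2"
        using simple_root_exists * by metis
      \<comment> \<open>Simple roots from both parts give simple components; uniqueness identifies
        them, although each part is saturated.\<close>
      then have "cl s = cl t" using simple[of s] simple[of t] u * by blast
      then have "s \<doteq> t" by (simp add: sim_iff)
      then show False using split_saturated[of \<Phi>1 \<Phi>2 s t] s t * by blast
    qed
  qed
  show "irreducible_inv R S \<Phi> \<longleftrightarrow> (\<exists>!C. simple_comp R S \<Phi> C)"
    by (rule iffI, rule 2, rule 1, assumption, rule 3, assumption)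
  show "irreducible_inv R S \<Phi> \<longleftrightarrow> ?multiples"
    by (rule iffI, rule 1, assumption, rule 3, rule 2, assumption)
qed

end

section \<open>Quotient root systems\<close>

lemma perp_proj_exists:
  fixes J :: "'a::euclidean_space set"
  shows "\<exists>p. (\<forall>j\<in>J. p \<bullet> j = 0) \<and> x - p \<in> span J"
proof -
  obtain y z where yz: "y \<in> span J" "\<And>w. w \<in> span J \<Longrightarrow> orthogonal z w" "x = y + z"
    using orthogonal_subspace_decomp_exists[of J x] by blast
  then have "\<forall>j\<in>J. z \<bullet> j = 0" using span_base by (auto simp: orthogonal_def)
  then show ?thesis using yz by (intro exI[of _ z]) simp
qed

lemma orth_span:
  fixes J :: "'a::real_inner set"
  shows "\<lbrakk>\<forall>j\<in>J. p \<bullet> j = 0; w \<in> span J\<rbrakk> \<Longrightarrow> p \<bullet> w = 0"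
  using orthogonal_to_span[of w J p] by (auto simp: orthogonal_def)

lemma perp_proj_eqI:
  assumes "\<forall>j\<in>J. p \<bullet> j = 0" "x - p \<in> span J"
  shows "perp_proj J x = p"
  unfolding perp_proj_def
proof (rule the_equality)
  fix q assume q: "(\<forall>j\<in>J. q \<bullet> j = 0) \<and> x - q \<in> span J"
  have "\<forall>j\<in>J. (q - p) \<bullet> j = 0" using q assms by (simp add: inner_diff_left)
  moreover have "(x - p) - (x - q) \<in> span J" using q assms span_diff by blast
  then have "q - p \<in> span J" by simp
  ultimately have "(q - p) \<bullet> (q - p) = 0" using orth_span by blast
  then show "q = p" by simp
qed (use assms in auto)

lemma perp_proj_orth: "j \<in> J \<Longrightarrow> perp_proj J x \<bullet> j = 0"
  and perp_proj_diff: "x - perp_proj J x \<in> span J"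
  using perp_proj_exists[of J x] perp_proj_eqI[of J _ x] by metis+

lemma linear_perp_proj: "linear (perp_proj J)"
proof (rule linearI)
  show "perp_proj J (x + y) = perp_proj J x + perp_proj J y" for x y
  proof (rule perp_proj_eqI)
    have "(x - perp_proj J x) + (y - perp_proj J y) \<in> span J"
      by (intro span_add perp_proj_diff)
    then show "x + y - (perp_proj J x + perp_proj J y) \<in> span J" by (simp add: algebra_simps)
  qed (simp add: perp_proj_orth inner_add_left)
  show "perp_proj J (r *\<^sub>R x) = r *\<^sub>R perp_proj J x" for r x
  proof (rule perp_proj_eqI)
    have "r *\<^sub>R (x - perp_proj J x) \<in> span J" by (intro span_scale perp_proj_diff)
    then show "r *\<^sub>R x - r *\<^sub>R perp_proj J x \<in> span J" by (simp add: algebra_simps)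
  qed (simp add: perp_proj_orth)
qed

lemma perp_proj_0_iff: "perp_proj J x = 0 \<longleftrightarrow> x \<in> span J"
  using perp_proj_diff[of x J] perp_proj_eqI[of J 0 x] by auto

text \<open>Both Cartan integers are negative. If one is -1, a reflection produces
  \<open>a + b\<close>; if both are at most -2, the squared norm of \<open>a + b\<close> is at most
  zero.\<close>

lemma root_system_add:
  assumes \<Delta>: "root_system \<Delta>" and a: "a \<in> \<Delta>" and b: "b \<in> \<Delta>" and neg: "a \<bullet> b < 0"
  shows "a + b \<in> insert 0 \<Delta>"
proof -
  have nz: "a \<bullet> a > 0" "b \<bullet> b > 0" using \<Delta> a b unfolding root_system_def by auto
  have refl: "x - (2 * (x \<bullet> y) / (y \<bullet> y)) *\<^sub>R y \<in> \<Delta>" if "x \<in> \<Delta>" "y \<in> \<Delta>" for x y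
    using \<Delta> that unfolding root_system_def by blast
  have int: "2 * (x \<bullet> y) / (y \<bullet> y) \<in> \<int>" if "x \<in> \<Delta>" "y \<in> \<Delta>" for x y
    using \<Delta> that unfolding root_system_def by blast
  obtain m n :: int where m: "2 * (b \<bullet> a) / (a \<bullet> a) = of_int m" and n: "2 * (a \<bullet> b) / (b \<bullet> b) = of_int n"
    using int a b by (meson Ints_cases)
  have mn: "2 * (a \<bullet> b) = of_int m * (a \<bullet> a)" "2 * (a \<bullet> b) = of_int n * (b \<bullet> b)"
    using m n nz by (simp_all add: field_simps inner_commute)
  have "of_int m * (a \<bullet> a) < 0" "of_int n * (b \<bullet> b) < 0" using mn neg by linarith+
  then have "m < 0" "n < 0" using nz by (simp_all add: mult_less_0_iff)
  then consider "m = -1" | "n = -1" | "m \<le> -2" "n \<le> -2" by linarith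
  then show ?thesis
  proof cases
    case 1
    then show ?thesis using refl[OF b a] unfolding m by (simp add: add.commute)
  next
    case 2
    then show ?thesis using refl[OF a b] unfolding n by simp
  next
    case 3
    have "of_int m * (a \<bullet> a) \<le> (-2) * (a \<bullet> a)"
      by (rule mult_right_mono) (use 3 nz in auto)
    moreover have "of_int n * (b \<bullet> b) \<le> (-2) * (b \<bullet> b)"
      by (rule mult_right_mono) (use 3 nz in auto)
    moreover have "(a + b) \<bullet> (a + b) = a \<bullet> a + b \<bullet> b + 2 * (a \<bullet> b)"
      by (simp add: inner_add_left inner_add_right inner_commute)
    ultimately have "(a + b) \<bullet> (a + b) \<le> 0" using mn by linarith
    then have "a + b = 0" by (metis inner_gt_zero_iff not_le)
    then show ?thesis by simp
  qed
qed

text \<open>The sum over a fibre of the projection is fixed by the reflections in \<open>J\<close>, so it is a positive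
  multiple of the projected root; this transfers the sign of inner products to the fibres.\<close>

lemma qrs_roots_add:
  assumes \<Delta>: "root_system \<Delta>" and J: "J \<subseteq> \<Delta>" and x: "x \<in> qrs_roots \<Delta> J" and y: "y \<in> qrs_roots \<Delta> J"
    and neg: "x \<bullet> y < 0"
  shows "x + y \<in> insert 0 (qrs_roots \<Delta> J)"
proof -
  interpret lin: linear "perp_proj J" by (rule linear_perp_proj)
  obtain a b where a: "a \<in> \<Delta>" "perp_proj J a = x" and b: "b \<in> \<Delta>" "perp_proj J b = y"
    using x y unfolding qrs_roots_def by blast
  define F where "F = {z \<in> \<Delta>. perp_proj J z = x}"
  have F: "finite F" "a \<in> F" using \<Delta> a by (auto simp: F_def root_system_def)
  define v where "v = (\<Sum>z\<in>F. z)"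
  have "v \<bullet> j = 0" if j: "j \<in> J" for j
  proof -
    have jD: "j \<in> \<Delta>" using j J by blast
    then have jj: "j \<bullet> j > 0" using \<Delta> unfolding root_system_def by auto
    define s where "s z = z - (2 * (z \<bullet> j) / (j \<bullet> j)) *\<^sub>R j" for z
    have ss: "s (s z) = z" for z using jj by (simp add: s_def inner_diff_left field_simps)
    have "perp_proj J j = 0" using j perp_proj_0_iff span_base by blast
    then have proj: "perp_proj J (s z) = perp_proj J z" for z by (simp add: s_def lin.diff lin.scale)
    have sF: "s z \<in> F" if "z \<in> F" for z
      using that \<Delta> jD proj unfolding F_def s_def root_system_def by simp
    have "v = (\<Sum>z\<in>F. s z)"
      unfolding v_def by (rule sum.reindex_bij_witness[of _ s s]) (auto simp: ss sF)
    also have "\<dots> = v - (2 * (v \<bullet> j) / (j \<bullet> j)) *\<^sub>R j"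
      by (simp add: s_def v_def sum_subtractf inner_sum_left sum_distrib_left sum_divide_distrib scaleR_left.sum)
    finally have "(2 * (v \<bullet> j) / (j \<bullet> j)) *\<^sub>R j = 0" by simp
    then show ?thesis using jj by auto
  qed
  then have "perp_proj J v = v" by (intro perp_proj_eqI) (auto simp: span_zero)
  moreover have "perp_proj J v = (\<Sum>z\<in>F. x)" by (simp add: v_def lin.sum F_def)
  ultimately have v: "v = of_nat (card F) *\<^sub>R x" by (simp add: sum_constant_scaleR)
  have x_orth: "\<forall>j\<in>J. x \<bullet> j = 0" using perp_proj_orth a(2) by metis
  \<comment> \<open>Since \<open>x\<close> is orthogonal to \<open>J\<close>, any lift
    \<open>b\<close> of \<open>y\<close> will do. As \<open>v\<close> is a positive multiple of
    \<open>x\<close>, some lift \<open>z\<close> of \<open>x\<close> has negative inner product with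
    \<open>b\<close>.\<close>
  have "x \<bullet> (b - y) = 0" using orth_span[OF x_orth] perp_proj_diff[of b J] b(2) by simp
  then have "x \<bullet> b = x \<bullet> y" by (simp add: inner_diff_right)
  then have "v \<bullet> b < 0"
    using v neg F by (simp add: mult_pos_neg card_gt_0_iff) (metis card_gt_0_iff empty_iff mult_pos_neg of_nat_0_less_iff)
  then have "(\<Sum>z\<in>F. z \<bullet> b) < 0" by (simp add: v_def inner_sum_left)
  then obtain z where z: "z \<in> F" "z \<bullet> b < 0" by (metis not_le sum_nonneg)
  have "z + b \<in> insert 0 \<Delta>" using root_system_add[OF \<Delta>] z b by (auto simp: F_def)
  then have "perp_proj J (z + b) \<in> insert 0 (qrs_roots \<Delta> J)"
  proof (cases "z + b = 0")
    case True
    then show ?thesis using lin.zero by simp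
  next
    case False
    then have "z + b \<in> \<Delta>" using \<open>z + b \<in> insert 0 \<Delta>\<close> by simp
    then show ?thesis by (cases "perp_proj J (z + b) = 0") (auto simp: qrs_roots_def)
  qed
  moreover have "perp_proj J (z + b) = x + y" using z b by (simp add: F_def lin.add)
  ultimately show ?thesis by simp
qed

lemma qrs_based_roots:
  assumes \<Delta>: "root_system \<Delta>" and \<Sigma>: "root_base \<Delta> \<Sigma>" and J: "J \<subseteq> \<Sigma>"
  shows "based_roots (qrs_roots \<Delta> J) (qrs_base \<Sigma> J)"
proof -
  interpret lin: linear "perp_proj J" by (rule linear_perp_proj)
  have sub: "\<Sigma> \<subseteq> \<Delta>" and ind: "independent \<Sigma>" using \<Sigma> by (auto simp: root_base_def)
  have finD: "finite \<Delta>" using \<Delta> by (simp add: root_system_def)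
  have fin: "finite \<Sigma>" "finite J"
    using finite_subset[OF sub finD] finite_subset[OF J] by simp_all
  \<comment> \<open>Independence of \<open>\<Sigma> - J\<close> modulo \<open>span J\<close>: it
    makes the projection injective on \<open>span (\<Sigma> - J)\<close>.\<close>
  have coeff0: "u \<sigma> = 0" if sp: "(\<Sum>\<sigma>\<in>\<Sigma> - J. u \<sigma> *\<^sub>R \<sigma>) \<in> span J" and \<sigma>: "\<sigma> \<in> \<Sigma> - J" for u \<sigma>
  proof -
    obtain w where w: "(\<Sum>\<sigma>\<in>\<Sigma> - J. u \<sigma> *\<^sub>R \<sigma>) = (\<Sum>j\<in>J. w j *\<^sub>R j)"
      using sp unfolding span_finite[OF fin(2)] by blast
    define c where "c \<tau> = (if \<tau> \<in> J then - w \<tau> else u \<tau>)" for \<tau>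
    have "(\<Sum>\<tau>\<in>\<Sigma>. c \<tau> *\<^sub>R \<tau>) = (\<Sum>\<tau>\<in>\<Sigma> - J. c \<tau> *\<^sub>R \<tau>) + (\<Sum>\<tau>\<in>J. c \<tau> *\<^sub>R \<tau>)"
      using J fin by (intro sum.subset_diff)
    also have "\<dots> = (\<Sum>\<tau>\<in>\<Sigma> - J. u \<tau> *\<^sub>R \<tau>) - (\<Sum>\<tau>\<in>J. w \<tau> *\<^sub>R \<tau>)"
      by (simp add: c_def sum_negf)
    also have "\<dots> = 0" using w by simp
    finally have "c \<sigma> = 0" using independentD[OF ind fin(1) order_refl] \<sigma> by blast
    then show ?thesis using \<sigma> by (simp add: c_def)
  qed
  have inj: "inj_on (perp_proj J) (span (\<Sigma> - J))"
  proof (rule inj_onI)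
    fix x y assume xy: "x \<in> span (\<Sigma> - J)" "y \<in> span (\<Sigma> - J)" and eq: "perp_proj J x = perp_proj J y"
    have finD: "finite (\<Sigma> - J)" using fin by simp
    obtain u w where uw: "x = (\<Sum>\<sigma>\<in>\<Sigma> - J. u \<sigma> *\<^sub>R \<sigma>)" "y = (\<Sum>\<sigma>\<in>\<Sigma> - J. w \<sigma> *\<^sub>R \<sigma>)"
      using xy unfolding span_finite[OF finD] by blast
    have "x - y \<in> span J" using eq perp_proj_0_iff[of J "x - y"] by (simp add: lin.diff)
    then have "(\<Sum>\<sigma>\<in>\<Sigma> - J. (u \<sigma> - w \<sigma>) *\<^sub>R \<sigma>) \<in> span J"
      unfolding uw by (simp add: sum_subtractf scaleR_diff_left)
    then have "u \<sigma> = w \<sigma>" if "\<sigma> \<in> \<Sigma> - J" for \<sigma>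
      using coeff0[of "\<lambda>\<sigma>. u \<sigma> - w \<sigma>"] that by force
    then show "x = y" unfolding uw by (intro sum.cong) auto
  qed
  have injS: "inj_on (perp_proj J) (\<Sigma> - J)" using inj inj_on_subset span_superset by blast
  show ?thesis
  proof
    show "finite (qrs_roots \<Delta> J)" using finD by (simp add: qrs_roots_def)
    show "finite (qrs_base \<Sigma> J)" using fin by (simp add: qrs_base_def)
    have "independent (\<Sigma> - J)" by (rule independent_mono[OF ind]) simp
    then show "independent (qrs_base \<Sigma> J)"
      unfolding qrs_base_def by (rule linear_independent_injective_image[OF linear_perp_proj _ inj])
    show "0 \<notin> qrs_roots \<Delta> J" by (auto simp: qrs_roots_def)
    show "qrs_base \<Sigma> J \<subseteq> qrs_roots \<Delta> J"
    proof
      fix x assume "x \<in> qrs_base \<Sigma> J"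
      then obtain \<sigma> where \<sigma>: "\<sigma> \<in> \<Sigma> - J" "x = perp_proj J \<sigma>" by (auto simp: qrs_base_def)
      have "\<sigma> = 0" if "perp_proj J \<sigma> = 0"
        using inj_onD[OF inj, of \<sigma> 0] that \<sigma>(1) by (simp add: span_base span_zero lin.zero)
      then have "perp_proj J \<sigma> \<noteq> 0" using \<sigma>(1) sub \<Delta> unfolding root_system_def by auto
      then show "x \<in> qrs_roots \<Delta> J" using \<sigma> sub unfolding qrs_roots_def by blast
    qed
    show "-x \<in> qrs_roots \<Delta> J" if x: "x \<in> qrs_roots \<Delta> J" for x
    proof -
      obtain a where a: "a \<in> \<Delta>" "x = perp_proj J a" "x \<noteq> 0" using x unfolding qrs_roots_def by blast
      have "a \<bullet> a \<noteq> 0" using a \<Delta> unfolding root_system_def by auto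
      moreover have "a - (2 * (a \<bullet> a) / (a \<bullet> a)) *\<^sub>R a \<in> \<Delta>"
        using a \<Delta> unfolding root_system_def by blast
      ultimately have "-a \<in> \<Delta>" by (simp add: scaleR_2)
      moreover have "-x = perp_proj J (-a)" using a by (simp add: lin.neg)
      ultimately show ?thesis using a(3) unfolding qrs_roots_def by fastforce
    qed
    show "\<lbrakk>x \<in> qrs_roots \<Delta> J; y \<in> qrs_roots \<Delta> J; x \<bullet> y < 0\<rbrakk> \<Longrightarrow> x + y \<in> insert 0 (qrs_roots \<Delta> J)" for x y
      using qrs_roots_add[OF \<Delta>] J sub by blast
    show "\<exists>c::'a \<Rightarrow> int. x = (\<Sum>\<theta>\<in>qrs_base \<Sigma> J. of_int (c \<theta>) *\<^sub>R \<theta>)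
      \<and> ((\<forall>\<theta>\<in>qrs_base \<Sigma> J. c \<theta> \<ge> 0) \<or> (\<forall>\<theta>\<in>qrs_base \<Sigma> J. c \<theta> \<le> 0))"
      if x: "x \<in> qrs_roots \<Delta> J" for x
    proof -
      obtain a where a: "a \<in> \<Delta>" "x = perp_proj J a" using x unfolding qrs_roots_def by blast
      obtain c :: "'a \<Rightarrow> int" where c: "a = (\<Sum>\<sigma>\<in>\<Sigma>. of_int (c \<sigma>) *\<^sub>R \<sigma>)"
        "(\<forall>\<sigma>\<in>\<Sigma>. c \<sigma> \<ge> 0) \<or> (\<forall>\<sigma>\<in>\<Sigma>. c \<sigma> \<le> 0)"
        using \<Sigma> a unfolding root_base_def by blast
      \<comment> \<open>The inverse of the projection on \<open>\<Sigma> - J\<close> transports the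
        coefficients of \<open>a\<close>. Terms from \<open>J\<close> project to zero, so the common
        sign survives.\<close>
      define g where "g = the_inv_into (\<Sigma> - J) (perp_proj J)"
      have g: "g (perp_proj J \<sigma>) = \<sigma>" if "\<sigma> \<in> \<Sigma> - J" for \<sigma>
        using the_inv_into_f_f[OF injS that] by (simp add: g_def)
      have "x = (\<Sum>\<sigma>\<in>\<Sigma>. of_int (c \<sigma>) *\<^sub>R perp_proj J \<sigma>)"
        unfolding a(2) by (subst c(1)) (simp add: lin.sum lin.scale)
      also have "\<dots> = (\<Sum>\<sigma>\<in>\<Sigma> - J. of_int (c \<sigma>) *\<^sub>R perp_proj J \<sigma>)"
      proof (rule sum.mono_neutral_right)
        show "\<forall>\<sigma>\<in>\<Sigma> - (\<Sigma> - J). of_int (c \<sigma>) *\<^sub>R perp_proj J \<sigma> = 0"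
          using perp_proj_0_iff[of J] span_base[of _ J] by auto
      qed (use fin in auto)
      also have "\<dots> = (\<Sum>\<theta>\<in>qrs_base \<Sigma> J. of_int (c (g \<theta>)) *\<^sub>R \<theta>)"
        unfolding qrs_base_def sum.reindex[OF injS] by (rule sum.cong) (auto simp: g)
      finally have "x = (\<Sum>\<theta>\<in>qrs_base \<Sigma> J. of_int (c (g \<theta>)) *\<^sub>R \<theta>)" .
      moreover have "g \<theta> \<in> \<Sigma>" if "\<theta> \<in> qrs_base \<Sigma> J" for \<theta>
        using that g by (auto simp: qrs_base_def)
      ultimately show ?thesis using c(2) by (intro exI[of _ "\<lambda>\<theta>. c (g \<theta>)"]) auto
    qed
  qed
qed

theorem theorem5p2:
  fixes \<Delta> \<Sigma> J \<Phi> :: "'a::euclidean_space set"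
  assumes "root_system \<Delta>" and "root_base \<Delta> \<Sigma>" and "J \<subset> \<Sigma>"
    and "inversion_set (qrs_roots \<Delta> J) (qrs_base \<Sigma> J) \<Phi>" and "\<Phi> \<noteq> {}"
  defines "R \<equiv> qrs_roots \<Delta> J" and "S \<equiv> qrs_base \<Sigma> J"
  shows "(irreducible_inv R S \<Phi>
            \<longleftrightarrow> (\<forall>C\<in>components R S \<Phi>. supp_set S C = supp_set S \<Phi>))
       \<and> (irreducible_inv R S \<Phi> \<longleftrightarrow> (\<exists>!C. simple_comp R S \<Phi> C))
       \<and> (irreducible_inv R S \<Phi> \<longleftrightarrow>
            (\<exists>A\<in>components R S \<Phi>. \<forall>C\<in>components R S \<Phi>. C \<noteq> A \<longrightarrow>
               (\<exists>k\<ge>1. comp_mult R S \<Phi> k A = Some C)))"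
proof -
  have "based_roots R S"
    unfolding R_def S_def by (rule qrs_based_roots[OF assms(1,2)]) (use assms(3) in simp)
  then interpret inversion R S \<Phi>
    by (rule inversion.intro) (use assms(4) in \<open>unfold_locales, simp add: R_def S_def\<close>)
  show ?thesis by (intro conjI irreducible_iff assms(5))
qed

end
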